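(* Let $(A,\Phi)$ be a compact quantum group. There is a unique left invariant state on $A$, i.e. a unique state $h$ on $A$ such that $(\iota\otimes h)\Phi(a)=h(a)1$ for all $a\in A$. This state is also right invariant, i.e. $(h\otimes\iota)\Phi(a)=h(a)1$ for all $a\in A$.
   Context: $A\otimes A$ denotes the minimal C$^*$-tensor product and $\iota$ the identity map; for $\omega\in A^*$, $\iota\otimes\omega$ and $\omega\otimes\iota$ are the slice maps $A\otimes A\to A$. A comultiplication on a unital C$^*$-algebra $A$ is a unital $^*$-homomorphism $\Phi:A\to A\otimes A$ with $(\Phi\otimes\iota)\Phi=(\iota\otimes\Phi)\Phi$. A compact quantum group is a pair $(A,\Phi)$ of a unital C$^*$-algebra $A$ and a comultiplication $\Phi$ on $A$ such that $\Phi(A)(1\otimes A)$ and $\Phi(A)(A\otimes 1)$ are dense in $A\otimes A$; here $\Phi(A)(1\otimes A)$ denotes the linear span of $\{\Phi(a)(1\otimes b): a,b\in A\}$, and similarly for $\Phi(A)(A\otimes 1)$. *)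

theory Defs
  imports "HOL-Analysis.Analysis"
begin

section \<open>Unital \<open>C\<^sup>*\<close>-algebras\<close>

class scaleC =
  fixes scaleC :: "complex \<Rightarrow> 'a \<Rightarrow> 'a" (infixr "*\<^sub>C" 75)

class complex_vector = real_vector + scaleC +
  assumes scaleC_add_right: "c *\<^sub>C (x + y) = c *\<^sub>C x + c *\<^sub>C y"
    and scaleC_add_left: "(c + d) *\<^sub>C x = c *\<^sub>C x + d *\<^sub>C x"
    and scaleC_scaleC: "c *\<^sub>C d *\<^sub>C x = (c * d) *\<^sub>C x"
    and scaleC_one: "1 *\<^sub>C x = x"
    and scaleR_scaleC: "r *\<^sub>R x = complex_of_real r *\<^sub>C x"

global_interpretation complex_vector: vector_space "scaleC :: complex \<Rightarrow> 'a \<Rightarrow> 'a::complex_vector"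
  by unfold_locales (simp_all add: scaleC_add_right scaleC_add_left scaleC_scaleC scaleC_one)

text \<open>
  The class \<^class>\<open>real_normed_algebra_1\<close> contains \<open>norm 1 = 1\<close>. The algebras below are thus
  nonzero, as is necessary for states to exist.
\<close>

class unital_cstar_algebra = real_normed_algebra_1 + banach + complex_vector +
  fixes star :: "'a \<Rightarrow> 'a"
  assumes norm_scaleC: "norm (c *\<^sub>C x) = cmod c * norm x"
    and mult_scaleC_left: "(c *\<^sub>C x) * y = c *\<^sub>C (x * y)"
    and mult_scaleC_right: "x * (c *\<^sub>C y) = c *\<^sub>C (x * y)"
    and star_add: "star (x + y) = star x + star y"
    and star_scaleC: "star (c *\<^sub>C x) = cnj c *\<^sub>C star x"
    and star_mult: "star (x * y) = star y * star x"
    and star_star: "star (star x) = x"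
    and cstar_identity: "norm (star x * x) = (norm x)\<^sup>2"

instantiation complex :: unital_cstar_algebra
begin

definition scaleC_complex :: "complex \<Rightarrow> complex \<Rightarrow> complex" where
  "scaleC_complex c x = c * x"

definition star_complex :: "complex \<Rightarrow> complex" where
  "star_complex = cnj"

instance
  by standard
    (simp_all add: scaleC_complex_def star_complex_def algebra_simps scaleR_conv_of_real
      norm_mult power2_eq_square)

end

definition clinear :: "('a::complex_vector \<Rightarrow> 'b::complex_vector) \<Rightarrow> bool" where
  "clinear f \<longleftrightarrow> (\<forall>x y. f (x + y) = f x + f y) \<and> (\<forall>c x. f (c *\<^sub>C x) = c *\<^sub>C f x)"

definition bounded_clinear ::
    "('a::{complex_vector,real_normed_vector} \<Rightarrow> 'b::{complex_vector,real_normed_vector}) \<Rightarrow> bool" where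
  "bounded_clinear f \<longleftrightarrow> clinear f \<and> bounded_linear f"

definition unital_star_hom :: "('a::unital_cstar_algebra \<Rightarrow> 'b::unital_cstar_algebra) \<Rightarrow> bool" where
  "unital_star_hom f \<longleftrightarrow>
     clinear f \<and> f 1 = 1 \<and> (\<forall>x y. f (x * y) = f x * f y) \<and> (\<forall>x. f (star x) = star (f x))"

definition state :: "('a::unital_cstar_algebra \<Rightarrow> complex) \<Rightarrow> bool" where
  "state h \<longleftrightarrow> clinear h \<and> (\<forall>a. h (star a * a) \<in> \<real>\<^sub>\<ge>\<^sub>0) \<and> h 1 = 1"


section \<open>The Hilbert spaces \<open>\<ell>\<^sup>2(I)\<close>\<close>

typedef 'i ell2 = "{x :: 'i \<Rightarrow> complex. (\<lambda>i. (cmod (x i))\<^sup>2) summable_on UNIV}"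
  morphisms ell2_apply Abs_ell2
  by (rule exI[of _ "\<lambda>_. 0"]) simp

setup_lifting type_definition_ell2

lemma sum_cmod_square_add_le:
  fixes x y :: "'i \<Rightarrow> complex"
  assumes x: "(\<lambda>i. (cmod (x i))\<^sup>2) summable_on UNIV"
    and y: "(\<lambda>i. (cmod (y i))\<^sup>2) summable_on UNIV" and F: "finite F"
  shows "(\<Sum>i\<in>F. (cmod (x i + y i))\<^sup>2)
    \<le> (sqrt (\<Sum>\<^sub>\<infinity>i. (cmod (x i))\<^sup>2) + sqrt (\<Sum>\<^sub>\<infinity>i. (cmod (y i))\<^sup>2))\<^sup>2"
proof -
  have "L2_set (\<lambda>i. cmod (x i + y i)) F \<le> L2_set (\<lambda>i. cmod (x i) + cmod (y i)) F"
    by (rule L2_set_mono) (auto intro: norm_triangle_ineq)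
  also have "\<dots> \<le> L2_set (\<lambda>i. cmod (x i)) F + L2_set (\<lambda>i. cmod (y i)) F"
    by (rule L2_set_triangle_ineq)
  also have "\<dots> \<le> sqrt (\<Sum>\<^sub>\<infinity>i. (cmod (x i))\<^sup>2) + sqrt (\<Sum>\<^sub>\<infinity>i. (cmod (y i))\<^sup>2)"
    unfolding L2_set_def
    by (intro add_mono real_sqrt_le_mono finite_sum_le_infsum x y F) auto
  finally have "(L2_set (\<lambda>i. cmod (x i + y i)) F)\<^sup>2
      \<le> (sqrt (\<Sum>\<^sub>\<infinity>i. (cmod (x i))\<^sup>2) + sqrt (\<Sum>\<^sub>\<infinity>i. (cmod (y i))\<^sup>2))\<^sup>2"
    by (rule power_mono) simp
  then show ?thesis
    by (simp add: L2_set_def sum_nonneg)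
qed

lemma square_summable_add:
  fixes x y :: "'i \<Rightarrow> complex"
  assumes "(\<lambda>i. (cmod (x i))\<^sup>2) summable_on UNIV" "(\<lambda>i. (cmod (y i))\<^sup>2) summable_on UNIV"
  shows "(\<lambda>i. (cmod (x i + y i))\<^sup>2) summable_on UNIV"
  by (rule nonneg_bdd_above_summable_on)
    (auto intro!: bdd_aboveI2 sum_cmod_square_add_le[OF assms])

lemma square_summable_cmult:
  fixes x :: "'i \<Rightarrow> complex"
  assumes "(\<lambda>i. (cmod (x i))\<^sup>2) summable_on UNIV"
  shows "(\<lambda>i. (cmod (c * x i))\<^sup>2) summable_on UNIV"
  using summable_on_cmult_right[OF assms, of "(cmod c)\<^sup>2"]
  by (simp add: norm_mult power_mult_distrib)

lemma square_summable_prod: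
  fixes x :: "'i \<Rightarrow> complex" and y :: "'j \<Rightarrow> complex"
  assumes x: "(\<lambda>i. (cmod (x i))\<^sup>2) summable_on UNIV" and y: "(\<lambda>j. (cmod (y j))\<^sup>2) summable_on UNIV"
  shows "(\<lambda>p. (cmod (x (fst p) * y (snd p)))\<^sup>2) summable_on UNIV"
proof -
  have "(\<lambda>p. (cmod (x (fst p) * y (snd p)))\<^sup>2) summable_on Sigma UNIV (\<lambda>_. UNIV)"
  proof (rule summable_on_SigmaI)
    fix i
    show "((\<lambda>j. (cmod (x (fst (i, j)) * y (snd (i, j))))\<^sup>2)
        has_sum (cmod (x i))\<^sup>2 * (\<Sum>\<^sub>\<infinity>j. (cmod (y j))\<^sup>2)) UNIV"
      using has_sum_cmult_right[OF has_sum_infsum[OF y], of "(cmod (x i))\<^sup>2"]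
      by (simp add: norm_mult power_mult_distrib)
  next
    show "(\<lambda>i. (cmod (x i))\<^sup>2 * (\<Sum>\<^sub>\<infinity>j. (cmod (y j))\<^sup>2)) summable_on UNIV"
      by (rule summable_on_cmult_left[OF x])
  qed auto
  then show ?thesis by simp
qed

instantiation ell2 :: (type) complex_vector
begin

lift_definition zero_ell2 :: "'a ell2" is "\<lambda>_. 0" by simp
lift_definition plus_ell2 :: "'a ell2 \<Rightarrow> 'a ell2 \<Rightarrow> 'a ell2" is "\<lambda>x y i. x i + y i"
  by (rule square_summable_add)
lift_definition scaleC_ell2 :: "complex \<Rightarrow> 'a ell2 \<Rightarrow> 'a ell2" is "\<lambda>c x i. c * x i"
  by (rule square_summable_cmult)
lift_definition uminus_ell2 :: "'a ell2 \<Rightarrow> 'a ell2" is "\<lambda>x i. - x i" by simp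
definition minus_ell2 :: "'a ell2 \<Rightarrow> 'a ell2 \<Rightarrow> 'a ell2" where "minus_ell2 x y = x + - y"
definition scaleR_ell2 :: "real \<Rightarrow> 'a ell2 \<Rightarrow> 'a ell2" where
  "scaleR_ell2 r x = complex_of_real r *\<^sub>C x"

instance
proof
  fix x y z :: "'a ell2" and a b :: real and c d :: complex
  show "x + y + z = x + (y + z)" by transfer (simp add: add.assoc)
  show "x + y = y + x" by transfer (simp add: add.commute)
  show "0 + x = x" by transfer simp
  show "- x + x = 0" by transfer simp
  show "x - y = x + - y" by (rule minus_ell2_def)
  show add_right: "c *\<^sub>C (x + y) = c *\<^sub>C x + c *\<^sub>C y" for c
    by transfer (simp add: distrib_left)
  show add_left: "(c + d) *\<^sub>C x = c *\<^sub>C x + d *\<^sub>C x" for c d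
    by transfer (simp add: distrib_right)
  show assoc: "c *\<^sub>C d *\<^sub>C x = (c * d) *\<^sub>C x" for c d
    by transfer (simp add: mult.assoc)
  show one: "1 *\<^sub>C x = x" by transfer simp
  show "a *\<^sub>R x = complex_of_real a *\<^sub>C x" by (rule scaleR_ell2_def)
  show "a *\<^sub>R (x + y) = a *\<^sub>R x + a *\<^sub>R y" by (simp add: scaleR_ell2_def add_right)
  show "(a + b) *\<^sub>R x = a *\<^sub>R x + b *\<^sub>R x" by (simp add: scaleR_ell2_def add_left)
  show "a *\<^sub>R b *\<^sub>R x = (a * b) *\<^sub>R x" by (simp add: scaleR_ell2_def assoc)
  show "1 *\<^sub>R x = x" by (simp add: scaleR_ell2_def one)
qed

end

instantiation ell2 :: (type) real_normed_vector
begin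

lift_definition norm_ell2 :: "'a ell2 \<Rightarrow> real" is "\<lambda>x. sqrt (\<Sum>\<^sub>\<infinity>i. (cmod (x i))\<^sup>2)" .
definition sgn_ell2 :: "'a ell2 \<Rightarrow> 'a ell2" where "sgn_ell2 x = inverse (norm x) *\<^sub>R x"
definition dist_ell2 :: "'a ell2 \<Rightarrow> 'a ell2 \<Rightarrow> real" where "dist_ell2 x y = norm (x - y)"
definition uniformity_ell2 :: "('a ell2 \<times> 'a ell2) filter" where
  "uniformity_ell2 = (INF e\<in>{0<..}. principal {(x, y). dist x y < e})"
definition open_ell2 :: "'a ell2 set \<Rightarrow> bool" where
  "open_ell2 U \<longleftrightarrow> (\<forall>x\<in>U. eventually (\<lambda>(x', y). x' = x \<longrightarrow> y \<in> U) uniformity)"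

instance
proof
  fix x y :: "'a ell2" and r :: real
  show "norm x = 0 \<longleftrightarrow> x = 0"
  proof transfer
    fix x :: "'a \<Rightarrow> complex"
    assume x: "(\<lambda>i. (cmod (x i))\<^sup>2) summable_on UNIV"
    show "sqrt (\<Sum>\<^sub>\<infinity>i. (cmod (x i))\<^sup>2) = 0 \<longleftrightarrow> x = (\<lambda>_. 0)"
    proof
      assume "sqrt (\<Sum>\<^sub>\<infinity>i. (cmod (x i))\<^sup>2) = 0"
      then have "(\<Sum>\<^sub>\<infinity>i. (cmod (x i))\<^sup>2) \<le> 0" by simp
      then have "(cmod (x i))\<^sup>2 = 0" for i
        by (rule nonneg_infsum_le_0D[OF _ x]) auto
      then show "x = (\<lambda>_. 0)" by (simp add: fun_eq_iff)
    qed simp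
  qed
  show "norm (x + y) \<le> norm x + norm y"
  proof transfer
    fix x y :: "'a \<Rightarrow> complex"
    assume x: "(\<lambda>i. (cmod (x i))\<^sup>2) summable_on UNIV" and y: "(\<lambda>i. (cmod (y i))\<^sup>2) summable_on UNIV"
    have "(\<Sum>\<^sub>\<infinity>i. (cmod (x i + y i))\<^sup>2)
        \<le> (sqrt (\<Sum>\<^sub>\<infinity>i. (cmod (x i))\<^sup>2) + sqrt (\<Sum>\<^sub>\<infinity>i. (cmod (y i))\<^sup>2))\<^sup>2"
      by (intro infsum_le_finite_sums square_summable_add sum_cmod_square_add_le x y)
    then show "sqrt (\<Sum>\<^sub>\<infinity>i. (cmod (x i + y i))\<^sup>2)
        \<le> sqrt (\<Sum>\<^sub>\<infinity>i. (cmod (x i))\<^sup>2) + sqrt (\<Sum>\<^sub>\<infinity>i. (cmod (y i))\<^sup>2)"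
      by (intro real_le_lsqrt) (auto intro!: infsum_nonneg add_nonneg_nonneg)
  qed
  show "norm (r *\<^sub>R x) = \<bar>r\<bar> * norm x"
    unfolding scaleR_ell2_def
    by transfer (simp add: norm_mult power_mult_distrib infsum_cmult_right' real_sqrt_mult)
qed (rule sgn_ell2_def dist_ell2_def uniformity_ell2_def open_ell2_def)+

end

text \<open>The inner product is conjugate linear in the first argument.\<close>

lift_definition ell2_inner :: "'i ell2 \<Rightarrow> 'i ell2 \<Rightarrow> complex" is
  "\<lambda>x y. \<Sum>\<^sub>\<infinity>i. cnj (x i) * y i" .

text \<open>Elementary tensors, for the identification of \<open>\<ell>\<^sup>2(I) \<otimes> \<ell>\<^sup>2(J)\<close> with \<open>\<ell>\<^sup>2(I \<times> J)\<close>.\<close>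

lift_definition ell2_tensor :: "'i ell2 \<Rightarrow> 'j ell2 \<Rightarrow> ('i \<times> 'j) ell2" is
  "\<lambda>x y p. x (fst p) * y (snd p)"
  by (rule square_summable_prod)


section \<open>The minimal tensor product\<close>

definition representation :: "('a::unital_cstar_algebra \<Rightarrow> 'i ell2 \<Rightarrow> 'i ell2) \<Rightarrow> bool" where
  "representation \<pi> \<longleftrightarrow>
     (\<forall>a. bounded_clinear (\<pi> a)) \<and>
     (\<forall>a b \<xi>. \<pi> (a + b) \<xi> = \<pi> a \<xi> + \<pi> b \<xi>) \<and>
     (\<forall>c a \<xi>. \<pi> (c *\<^sub>C a) \<xi> = c *\<^sub>C \<pi> a \<xi>) \<and>
     (\<forall>a b \<xi>. \<pi> (a * b) \<xi> = \<pi> a (\<pi> b \<xi>)) \<and>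
     (\<forall>\<xi>. \<pi> 1 \<xi> = \<xi>) \<and>
     (\<forall>a \<xi> \<eta>. ell2_inner (\<pi> (star a) \<xi>) \<eta> = ell2_inner \<xi> (\<pi> a \<eta>))"

text \<open>
  \<open>min_tensor t\<close> says that the algebra \<open>'c\<close>, with \<open>t a b\<close> in the role of \<open>a \<otimes> b\<close>, is the minimal
  (spatial) tensor product of \<open>'a\<close> and \<open>'b\<close>: there are faithful representations \<open>\<pi>\<close>, \<open>\<sigma>\<close> on
  Hilbert spaces \<open>H\<close>, \<open>K\<close> and an isometric representation of \<open>'c\<close> on \<open>H \<otimes> K\<close> which maps \<open>t a b\<close>
  to \<open>\<pi>(a) \<otimes> \<sigma>(b)\<close>, and the elements \<open>t a b\<close> span a dense subspace. Hence the norm on this span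
  is \<open>\<parallel>\<Sum> a\<^sub>i \<otimes> b\<^sub>i\<parallel> = \<parallel>\<Sum> \<pi>(a\<^sub>i) \<otimes> \<sigma>(b\<^sub>i)\<parallel>\<close>, which does not depend on the choice of \<open>\<pi>\<close> and \<open>\<sigma>\<close>.

  Taking \<open>H = \<ell>\<^sup>2('a)\<close> and \<open>K = \<ell>\<^sup>2('b)\<close> is no restriction: cyclic representations of a
  unital \<open>C\<^sup>*\<close>-algebra \<open>A\<close> have dimension at most \<open>|A|\<close>, and at most \<open>|A|\<close> of them are needed to
  separate points, so (after adding multiplicities) \<open>A\<close> has a faithful unital representation on a
  Hilbert space of dimension exactly \<open>|A|\<close>.
\<close>

definition min_tensor ::
    "('a::unital_cstar_algebra \<Rightarrow> 'b::unital_cstar_algebra \<Rightarrow> 'c::unital_cstar_algebra) \<Rightarrow> bool" where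
  "min_tensor t \<longleftrightarrow>
     closure (complex_vector.span {t a b | a b. True}) = UNIV \<and>
     (\<exists>(\<pi> :: 'a \<Rightarrow> 'a ell2 \<Rightarrow> 'a ell2) (\<sigma> :: 'b \<Rightarrow> 'b ell2 \<Rightarrow> 'b ell2)
        (\<rho> :: 'c \<Rightarrow> ('a \<times> 'b) ell2 \<Rightarrow> ('a \<times> 'b) ell2).
        representation \<pi> \<and> inj \<pi> \<and> representation \<sigma> \<and> inj \<sigma> \<and>
        representation \<rho> \<and> (\<forall>x. onorm (\<rho> x) = norm x) \<and>
        (\<forall>a b \<xi> \<eta>. \<rho> (t a b) (ell2_tensor \<xi> \<eta>) = ell2_tensor (\<pi> a \<xi>) (\<sigma> b \<eta>)))"

text \<open>The slice maps \<open>\<iota> \<otimes> \<omega>\<close> and \<open>\<omega> \<otimes> \<iota>\<close>.\<close>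

definition slice_right ::
    "('a::unital_cstar_algebra \<Rightarrow> 'b::unital_cstar_algebra \<Rightarrow> 'c::unital_cstar_algebra) \<Rightarrow>
     ('b \<Rightarrow> complex) \<Rightarrow> 'c \<Rightarrow> 'a" where
  "slice_right t \<omega> = (THE S. bounded_clinear S \<and> (\<forall>a b. S (t a b) = \<omega> b *\<^sub>C a))"

definition slice_left ::
    "('a::unital_cstar_algebra \<Rightarrow> 'b::unital_cstar_algebra \<Rightarrow> 'c::unital_cstar_algebra) \<Rightarrow>
     ('a \<Rightarrow> complex) \<Rightarrow> 'c \<Rightarrow> 'b" where
  "slice_left t \<omega> = (THE S. bounded_clinear S \<and> (\<forall>a b. S (t a b) = \<omega> a *\<^sub>C b))"


section \<open>Compact quantum groups\<close>

text \<open>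
  \<open>min_tensor_cube t tL tR\<close>: \<open>'t\<close> is \<open>A \<otimes> A\<close>, and \<open>'u\<close> is \<open>A \<otimes> A \<otimes> A\<close>, viewed both as
  \<open>(A \<otimes> A) \<otimes> A\<close> (via \<open>tL\<close>) and as \<open>A \<otimes> (A \<otimes> A)\<close> (via \<open>tR\<close>), with the usual identification
  \<open>(a \<otimes> b) \<otimes> c = a \<otimes> (b \<otimes> c)\<close>.
\<close>

definition min_tensor_cube ::
    "('a::unital_cstar_algebra \<Rightarrow> 'a \<Rightarrow> 't::unital_cstar_algebra) \<Rightarrow>
     ('t \<Rightarrow> 'a \<Rightarrow> 'u::unital_cstar_algebra) \<Rightarrow> ('a \<Rightarrow> 't \<Rightarrow> 'u) \<Rightarrow> bool" where
  "min_tensor_cube t tL tR \<longleftrightarrow>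
     min_tensor t \<and> min_tensor tL \<and> min_tensor tR \<and> (\<forall>a b c. tL (t a b) c = tR a (t b c))"

text \<open>
  In the next definition \<open>F\<close> is \<open>\<Phi> \<otimes> \<iota>\<close> and \<open>G\<close> is \<open>\<iota> \<otimes> \<Phi>\<close>, i.e. the continuous linear extensions
  of \<open>a \<otimes> b \<mapsto> \<Phi>(a) \<otimes> b\<close> and \<open>a \<otimes> b \<mapsto> a \<otimes> \<Phi>(b)\<close>. These always exist for a unital
  *-homomorphism \<open>\<Phi>\<close> on a minimal tensor product, and they are unique by density.
\<close>

definition comultiplication ::
    "('a::unital_cstar_algebra \<Rightarrow> 'a \<Rightarrow> 't::unital_cstar_algebra) \<Rightarrow>
     ('t \<Rightarrow> 'a \<Rightarrow> 'u::unital_cstar_algebra) \<Rightarrow> ('a \<Rightarrow> 't \<Rightarrow> 'u) \<Rightarrow> ('a \<Rightarrow> 't) \<Rightarrow> bool" where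
  "comultiplication t tL tR \<Phi> \<longleftrightarrow>
     unital_star_hom \<Phi> \<and>
     (\<exists>F G. bounded_clinear F \<and> (\<forall>a b. F (t a b) = tL (\<Phi> a) b) \<and>
            bounded_clinear G \<and> (\<forall>a b. G (t a b) = tR a (\<Phi> b)) \<and>
            (\<forall>a. F (\<Phi> a) = G (\<Phi> a)))"

definition compact_quantum_group ::
    "('a::unital_cstar_algebra \<Rightarrow> 'a \<Rightarrow> 't::unital_cstar_algebra) \<Rightarrow>
     ('t \<Rightarrow> 'a \<Rightarrow> 'u::unital_cstar_algebra) \<Rightarrow> ('a \<Rightarrow> 't \<Rightarrow> 'u) \<Rightarrow> ('a \<Rightarrow> 't) \<Rightarrow> bool" where
  "compact_quantum_group t tL tR \<Phi> \<longleftrightarrow>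
     min_tensor_cube t tL tR \<and>
     comultiplication t tL tR \<Phi> \<and>
     closure (complex_vector.span {\<Phi> a * t 1 b | a b. True}) = UNIV \<and>
     closure (complex_vector.span {\<Phi> a * t b 1 | a b. True}) = UNIV"

definition left_invariant ::
    "('a::unital_cstar_algebra \<Rightarrow> 'a \<Rightarrow> 't::unital_cstar_algebra) \<Rightarrow> ('a \<Rightarrow> 't) \<Rightarrow>
     ('a \<Rightarrow> complex) \<Rightarrow> bool" where
  "left_invariant t \<Phi> h \<longleftrightarrow> (\<forall>a. slice_right t h (\<Phi> a) = h a *\<^sub>C 1)"

definition right_invariant ::
    "('a::unital_cstar_algebra \<Rightarrow> 'a \<Rightarrow> 't::unital_cstar_algebra) \<Rightarrow> ('a \<Rightarrow> 't) \<Rightarrow>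
     ('a \<Rightarrow> complex) \<Rightarrow> bool" where
  "right_invariant t \<Phi> h \<longleftrightarrow> (\<forall>a. slice_left t h (\<Phi> a) = h a *\<^sub>C 1)"

end

theory Submission
  imports Defs
begin

text \<open>
  For states \<open>\<omega>\<close>, \<open>\<rho>\<close> put \<open>\<omega> * \<rho> = (\<omega> \<otimes> \<rho>)\<Phi>\<close>. A weak* cluster point \<open>h\<close> of the Cesaro means of the powers of
  \<open>\<omega>\<close> satisfies \<open>\<omega> * h = h * \<omega> = h\<close>. By density of \<open>\<Phi>(A)(A \<otimes> 1)\<close> this implies \<open>\<rho> * h = \<rho>(1) h\<close> for all
  positive \<open>\<rho> \<le> \<omega>\<close>. So the weak* compact sets \<open>{h. \<omega> * h = h}\<close> have the finite intersection property
  (take the mean of finitely many states \<open>\<omega>\<close>), and a state in all of them is left invariant. Flipping the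
  tensor factors gives a right invariant state \<open>k\<close>, and then \<open>g = k * g = k\<close> for each left invariant state \<open>g\<close>.

  The slice maps of the minimal tensor product, and their positivity, are obtained from the fact that
  the vector functionals of a faithful representation determine order and norm.
\<close>

section \<open>Square roots in C*-algebras\<close>

text \<open>Domination is what lets a mean of finitely many states control each of them: the mean
  minus a positive multiple of one member is still positive. In general no single state dominates
  multiples of all others, hence the compactness argument. The domination step needs both equations
  for \<open>h\<close>: \<open>conv \<omega> h = h\<close> makes \<open>b = E h a\<close> a fixed
  point of \<open>E \<omega>\<close>, and \<open>conv h \<omega> = h\<close> makes \<open>h\<close>
  agree on \<open>E \<omega> (star b * b)\<close> and \<open>star b * b\<close>. The analytic
  obstacle is that A \<otimes> A is known only as the closure of the span of elementary tensors. A
  slice is therefore found as the element with prescribed values on a separating family of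
  functionals. No spectral theory enters: positive elements are squares, roots come from one norm
  convergent iteration, and norms are bounded by completing \<open>a * a\<close> with a commuting
  square to a scalar. Splitting into real and imaginary parts costs a factor 2, the origin of the
  constants 2 and 4.\<close>

lemma star_zero [simp]: "star (0::'a::unital_cstar_algebra) = 0"
  using star_scaleC[of 0 "0::'a"] by simp

lemma star_uminus [simp]: "star (- x) = - star (x::'a::unital_cstar_algebra)"
  using star_add[of x "- x"] by (simp add: eq_neg_iff_add_eq_0 add.commute)

lemma star_diff: "star (x - y) = star x - star (y::'a::unital_cstar_algebra)"
  using star_add[of x "- y"] by simp

lemma star_one [simp]: "star (1::'a::unital_cstar_algebra) = 1"
  using star_mult[of "star (1::'a)" 1] by (simp add: star_star)

lemma star_scaleR: "star (r *\<^sub>R x) = r *\<^sub>R star (x::'a::unital_cstar_algebra)"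
  by (simp add: scaleR_scaleC star_scaleC)

lemma norm_star [simp]: "norm (star x) = norm (x::'a::unital_cstar_algebra)"
proof -
  have le: "norm y \<le> norm (star y)" for y :: 'a
  proof (cases "y = 0")
    case False
    have "norm y * norm y \<le> norm (star y) * norm y"
      using cstar_identity[of y] norm_mult_ineq[of "star y" y] by (simp add: power2_eq_square)
    then show ?thesis using False by simp
  qed simp
  show ?thesis using le[of x] le[of "star x"] by (simp add: star_star)
qed

lemma bounded_linear_star: "bounded_linear (star :: 'a::unital_cstar_algebra \<Rightarrow> 'a)"
  by (rule bounded_linear_intro[where K = 1]) (simp_all add: star_add star_scaleR)

text \<open>\<open>a\<close> is the real part of \<open>u = a + \<i> *\<^sub>C c\<close>, and
  commutation makes \<open>star u * u\<close> the scalar \<open>r * r\<close>, so \<open>u\<close>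
  has norm \<open>r\<close>. Later, \<open>norm a\<close> is bounded by exhibiting such a
  \<open>c\<close>.\<close>

lemma norm_le_of_commuting_squares:
  fixes a c :: "'a::unital_cstar_algebra"
  assumes "star a = a" "star c = c" "a * c = c * a" and sq: "a * a + c * c = (r * r) *\<^sub>R 1"
    and "0 \<le> r"
  shows "norm a \<le> r"
proof -
  define u where "u = a + \<i> *\<^sub>C c"
  have su: "star u = a - \<i> *\<^sub>C c"
    using assms by (simp add: u_def star_add star_scaleC)
  have "star u * u = a * a + c * c"
    unfolding su unfolding u_def using assms(3)
    by (simp add: algebra_simps mult_scaleC_left mult_scaleC_right scaleC_scaleC)
  then have "(norm u)\<^sup>2 = r\<^sup>2"
    using cstar_identity[of u] sq by (simp add: power2_eq_square)
  then have nu: "norm u = r" using \<open>0 \<le> r\<close> by simp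
  have "2 *\<^sub>R a = u + star u" unfolding su by (simp add: u_def scaleR_2)
  then have "2 * norm a = norm (u + star u)"
    by (metis abs_numeral norm_scaleR)
  also have "\<dots> \<le> 2 * r" using norm_triangle_ineq[of u "star u"] nu by simp
  finally show ?thesis by simp
qed

text \<open>The root is \<open>1 - y\<close>, where \<open>y\<close> is the limit of the iteration \<open>y \<mapsto> (x + y\<^sup>2) / 2\<close> from \<open>0\<close>.
  The same iteration with \<open>x = 1\<close> in the reals increases and dominates the increments.\<close>

lemma sqrt_one_minus:
  fixes x :: "'a::unital_cstar_algebra"
  assumes nx: "norm x \<le> 1" and sx: "star x = x"
  obtains s where "star s = s" "s * s = 1 - x" "norm (1 - s) \<le> 1"
    "\<And>z. z * x = x * z \<Longrightarrow> z * s = s * z"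
proof -
  define y where "y = rec_nat (0::'a) (\<lambda>n v. (1/2) *\<^sub>R (x + v * v))"
  define q where "q = rec_nat (0::real) (\<lambda>n v. (1 + v * v) / 2)"
  have y0: "y 0 = 0" and yS: "y (Suc n) = (1/2) *\<^sub>R (x + y n * y n)" for n
    by (simp_all add: y_def)
  have q0: "q 0 = 0" and qS: "q (Suc n) = (1 + q n * q n) / 2" for n
    by (simp_all add: q_def)
  have q01: "0 \<le> q n \<and> q n \<le> 1" for n
    by (induction n) (auto simp: q0 qS mult_le_one)
  have qmono: "q n \<le> q (Suc n)" for n
  proof -
    have "0 \<le> (1 - q n) * (1 - q n)" by simp
    then show ?thesis by (simp add: qS algebra_simps)
  qed
  have ny: "norm (y n) \<le> q n" for n
  proof (induction n)
    case (Suc n)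
    have "norm (y n * y n) \<le> q n * q n"
      using norm_mult_ineq[of "y n" "y n"] Suc
      by (meson dual_order.trans mult_mono norm_ge_zero q01)
    then show ?case
      using norm_triangle_ineq[of x "y n * y n"] nx by (simp add: yS qS)
  qed (simp add: y0 q0)
  have dy: "norm (y (Suc n) - y n) \<le> q (Suc n) - q n" for n
  proof (induction n)
    case 0
    then show ?case using nx by (simp add: y0 q0 yS qS)
  next
    case (Suc n)
    define d where "d = y (Suc n) - y n"
    \<comment> \<open>A difference of squares with the factors arranged so that the mixed products
      cancel without commutativity; the same identity for \<open>q\<close> gives the bound.\<close>
    have "y (Suc (Suc n)) - y (Suc n) = (1/2) *\<^sub>R (y (Suc n) * d + d * y n)"
      unfolding d_def yS[of "Suc n"] by (subst (3) yS) (simp add: algebra_simps)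
    then have "norm (y (Suc (Suc n)) - y (Suc n)) \<le> (norm (y (Suc n) * d) + norm (d * y n)) / 2"
      using norm_triangle_ineq[of "y (Suc n) * d" "d * y n"] by simp
    also have "\<dots> \<le> (q (Suc n) * (q (Suc n) - q n) + (q (Suc n) - q n) * q n) / 2"
    proof -
      have "norm (y (Suc n) * d) \<le> q (Suc n) * (q (Suc n) - q n)"
        using norm_mult_ineq[of "y (Suc n)" d] Suc ny[of "Suc n"] q01[of "Suc n"]
        unfolding d_def[symmetric] by (meson dual_order.trans mult_mono norm_ge_zero)
      moreover have "norm (d * y n) \<le> (q (Suc n) - q n) * q n"
        using norm_mult_ineq[of d "y n"] Suc ny[of n] qmono[of n]
        unfolding d_def[symmetric]
        by (meson diff_ge_0_iff_ge dual_order.trans mult_mono norm_ge_zero)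
      ultimately show ?thesis by simp
    qed
    also have "\<dots> = q (Suc (Suc n)) - q (Suc n)"
      unfolding qS[of "Suc n"] unfolding qS[of n] by (simp add: field_simps)
    finally show ?case .
  qed
  have "incseq q" using qmono by (rule incseq_SucI)
  then obtain l where "q \<longlonglongrightarrow> l"
    using incseq_convergent[of q 1] q01 by blast
  then have "summable (\<lambda>n. q (Suc n) - q n)" by (rule telescope_summable)
  then have "summable (\<lambda>n. y (Suc n) - y n)"
    by (rule summable_comparison_test[rotated]) (use dy in auto)
  then have "(\<lambda>n. \<Sum>k<n. y (Suc k) - y k) \<longlonglongrightarrow> (\<Sum>n. y (Suc n) - y n)"
    by (rule summable_LIMSEQ)
  then obtain L where L: "y \<longlonglongrightarrow> L"
    by (auto simp: sum_lessThan_telescope y0)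
  have ystar: "star (y n) = y n" for n
    by (induction n) (simp_all add: y0 yS star_scaleR star_add star_mult sx)
  have Lstar: "star L = L"
    using bounded_linear.tendsto[OF bounded_linear_star L] L by (simp add: ystar LIMSEQ_unique)
  have ycomm: "z * y n = y n * z" if z: "z * x = x * z" for z n
  proof (induction n)
    case (Suc n)
    then have "z * (y n * y n) = (y n * y n) * z"
      by (metis mult.assoc)
    then show ?case using z by (simp add: yS algebra_simps)
  qed (simp add: y0)
  have Lcomm: "z * L = L * z" if z: "z * x = x * z" for z
    using tendsto_mult_left[OF L, of z] tendsto_mult_right[OF L, of z]
    by (simp add: ycomm[OF z] LIMSEQ_unique)
  \<comment> \<open>For the root \<open>s = 1 - L\<close> this says
    \<open>norm (1 - s) \<le> 1\<close>, so that \<open>s = 1 - (1 - s)\<close> has a root in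
    turn.\<close>
  have nL: "norm L \<le> 1"
    using LIMSEQ_le_const2[OF tendsto_norm[OF L], of 1] ny q01 by (meson dual_order.trans)
  have "(\<lambda>n. (1/2) *\<^sub>R (x + y n * y n)) \<longlonglongrightarrow> (1/2) *\<^sub>R (x + L * L)"
    by (intro tendsto_intros L)
  moreover have "(\<lambda>n. (1/2) *\<^sub>R (x + y n * y n)) \<longlonglongrightarrow> L"
    using LIMSEQ_Suc[OF L] by (simp add: yS)
  ultimately have "L = (1/2) *\<^sub>R (x + L * L)" by (metis LIMSEQ_unique)
  then have LL: "L + L = x + L * L"
    by (metis add.commute scaleR_half_double scaleR_right_distrib)
  have "(1 - L) * (1 - L) = 1 - (L + L) + L * L" by (simp add: algebra_simps)
  also have "\<dots> = 1 - x" unfolding LL by simp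
  finally have sq: "(1 - L) * (1 - L) = 1 - x" .
  have comm: "z * (1 - L) = (1 - L) * z" if "z * x = x * z" for z
    using Lcomm[OF that] by (simp add: algebra_simps)
  show thesis
    by (rule that[OF _ sq _ comm]) (simp_all add: star_diff Lstar nL)
qed

section \<open>Positive functionals and faithful families\<close>

text \<open>Normalisation is dropped because vector functionals and functionals below a state are in
  general not states.\<close>

definition pos_functional :: "('a::unital_cstar_algebra \<Rightarrow> complex) \<Rightarrow> bool" where
  "pos_functional f \<longleftrightarrow> clinear f \<and> (\<forall>a. f (star a * a) \<in> \<real>\<^sub>\<ge>\<^sub>0)"

lemma state_iff_pos_functional: "state f \<longleftrightarrow> pos_functional f \<and> f 1 = 1"
  by (auto simp: state_def pos_functional_def)

lemma clinear_add: "clinear f \<Longrightarrow> f (x + y) = f x + f y"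
  and clinear_scaleC: "clinear f \<Longrightarrow> f (c *\<^sub>C x) = c *\<^sub>C f x"
  by (simp_all add: clinear_def)

lemma clinear_zero: "clinear f \<Longrightarrow> f 0 = 0"
  using clinear_scaleC[of f 0 0] by simp

lemma clinear_uminus: "clinear f \<Longrightarrow> f (- x) = - f x"
  using clinear_scaleC[of f "-1" x] by simp

lemma clinear_diff: "clinear f \<Longrightarrow> f (x - y) = f x - f y"
  using clinear_add[of f x "- y"] by (simp add: clinear_uminus)

lemma clinear_scaleR: "clinear f \<Longrightarrow> f (r *\<^sub>R x) = r *\<^sub>R f x"
  by (simp add: scaleR_scaleC clinear_scaleC)

lemma clinear_compose: "clinear f \<Longrightarrow> clinear g \<Longrightarrow> clinear (\<lambda>x. f (g x))"
  by (simp add: clinear_def)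

lemma bounded_clinear_clinear: "bounded_clinear f \<Longrightarrow> clinear f"
  and bounded_clinear_bounded_linear: "bounded_clinear f \<Longrightarrow> bounded_linear f"
  by (simp_all add: bounded_clinear_def)

lemma bounded_clinearI:
  assumes "clinear f" "\<And>x. norm (f x) \<le> K * norm x"
  shows "bounded_clinear f"
  unfolding bounded_clinear_def
  using assms
  by (auto intro!: bounded_linear_intro[where K = K]
      simp: clinear_add clinear_scaleR mult.commute)

lemma bounded_clinear_compose:
  "bounded_clinear f \<Longrightarrow> bounded_clinear g \<Longrightarrow> bounded_clinear (\<lambda>x. f (g x))"
  by (simp add: bounded_clinear_def clinear_compose bounded_linear_compose)

lemmas clinear_simps = clinear_add clinear_diff clinear_scaleC clinear_scaleR clinear_zero clinear_uminus

lemma pos_functional_clinear: "pos_functional f \<Longrightarrow> clinear f"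
  and pos_functional_nonneg: "pos_functional f \<Longrightarrow> f (star a * a) \<in> \<real>\<^sub>\<ge>\<^sub>0"
  by (simp_all add: pos_functional_def)

lemma pos_functional_one: "pos_functional f \<Longrightarrow> f 1 \<in> \<real>\<^sub>\<ge>\<^sub>0"
  using pos_functional_nonneg[of f 1] by simp

lemma pos_functional_form:
  assumes f: "pos_functional f"
  shows "f (star a * a) + c * f (star a * b) + cnj c * f (star b * a)
    + (c * cnj c) * f (star b * b) \<in> \<real>\<^sub>\<ge>\<^sub>0"
proof -
  have "star (a + c *\<^sub>C b) * (a + c *\<^sub>C b)
      = star a * a + c *\<^sub>C (star a * b) + cnj c *\<^sub>C (star b * a) + (c * cnj c) *\<^sub>C (star b * b)"
    by (simp add: star_add star_scaleC algebra_simps mult_scaleC_left mult_scaleC_right scaleC_scaleC)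
  then show ?thesis
    using pos_functional_nonneg[OF f, of "a + c *\<^sub>C b"] pos_functional_clinear[OF f]
    by (simp add: clinear_simps scaleC_complex_def algebra_simps)
qed

lemma pos_functional_hermitian:
  assumes f: "pos_functional f"
  shows "f (star b * a) = cnj (f (star a * b))"
proof -
  note p = pos_functional_form[OF f, of a _ b] pos_functional_nonneg[OF f, of a]
    pos_functional_nonneg[OF f, of b]
  \<comment> \<open>The form is real: \<open>c = 1\<close> compares imaginary parts,
    \<open>c = \<i>\<close> real parts.\<close>
  show ?thesis using p(1)[of 1] p(1)[of \<i>] p(2,3)
    by (auto simp: complex_eq_iff complex_nonneg_Reals_iff)
qed

lemma pos_functional_star: "pos_functional f \<Longrightarrow> f (star a) = cnj (f a)"
  using pos_functional_hermitian[of f a 1] by simp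

text \<open>Cauchy-Schwarz in the degenerate case: along \<open>star b + c *\<^sub>C a\<close> the
  form has no quadratic term in \<open>c\<close>, so a nonzero linear term would make it
  negative.\<close>

lemma pos_functional_null:
  assumes f: "pos_functional f" and z: "f (star a * a) = 0"
  shows "f (b * a) = 0"
proof (rule ccontr)
  define w where "w = f (b * a)"
  define k where "k = Re (f (b * star b))"
  assume "f (b * a) \<noteq> 0"
  then have w: "cmod w > 0" by (simp add: w_def)
  \<comment> \<open>Chosen so that the two cross terms add up to \<open>- (k + 1)\<close> and the
    form takes the value \<open>-1\<close>.\<close>
  define r where "r = (k + 1) / (2 * (cmod w)\<^sup>2)"
  have "f (b * star b) + - of_real r * cnj w * w + cnj (- of_real r * cnj w) * cnj w \<in> \<real>\<^sub>\<ge>\<^sub>0"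
    using pos_functional_form[OF f, of "star b" "- of_real r * cnj w" a]
      pos_functional_hermitian[OF f, of a "star b"] z
    by (simp add: star_star w_def)
  moreover have "- of_real r * cnj w * w = - of_real (r * (cmod w)\<^sup>2)"
    "cnj (- of_real r * cnj w) * cnj w = - of_real (r * (cmod w)\<^sup>2)"
    by (simp_all only: of_real_mult complex_norm_square[of w] complex_cnj_mult complex_cnj_minus
        complex_cnj_cnj complex_cnj_complex_of_real) (simp_all add: mult_ac)
  ultimately have "f (b * star b) - of_real (r * (cmod w)\<^sup>2) - of_real (r * (cmod w)\<^sup>2) \<in> \<real>\<^sub>\<ge>\<^sub>0"
    by (metis add_uminus_conv_diff)
  then have "0 \<le> k - 2 * r * (cmod w)\<^sup>2"
    unfolding complex_nonneg_Reals_iff k_def by (simp del: of_real_mult of_real_power)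
  moreover have "2 * r * (cmod w)\<^sup>2 = k + 1" using w by (simp add: r_def)
  ultimately show False by simp
qed

text \<open>Once normalised, a self-adjoint element lies below \<open>1\<close>, because the
  difference is the square of a self-adjoint root. This is used for \<open>a\<close> and
  \<open>- a\<close>.\<close>

lemma pos_functional_self_adjoint_bound:
  assumes f: "pos_functional f" and sa: "star a = a"
  shows "f a \<in> \<real>" "\<bar>Re (f a)\<bar> \<le> Re (f 1) * norm a"
proof -
  note lin = pos_functional_clinear[OF f]
  show "f a \<in> \<real>"
    using pos_functional_star[OF f, of a] sa by (simp add: Reals_cnj_iff)
  have le: "Re (f b) \<le> Re (f 1) * norm b" if sb: "star b = b" for b
  proof (cases "b = 0")
    case True
    then show ?thesis by (simp add: clinear_zero[OF lin])
  next
    case False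
    have "norm ((1 / norm b) *\<^sub>R b) \<le> 1" "star ((1 / norm b) *\<^sub>R b) = (1 / norm b) *\<^sub>R b"
      using False sb by (simp_all add: star_scaleR)
    then obtain s where "star s = s" "s * s = 1 - (1 / norm b) *\<^sub>R b"
      using sqrt_one_minus by blast
    then have "f (1 - (1 / norm b) *\<^sub>R b) \<in> \<real>\<^sub>\<ge>\<^sub>0"
      using pos_functional_nonneg[OF f, of s] by simp
    then show ?thesis
      using False by (simp add: clinear_simps[OF lin] complex_nonneg_Reals_iff field_simps)
  qed
  show "\<bar>Re (f a)\<bar> \<le> Re (f 1) * norm a"
    using le[of a] le[of "- a"] sa by (simp add: clinear_simps[OF lin])
qed

section \<open>Real and imaginary parts, and boundedness of positive functionals\<close>

definition re_part :: "'a::unital_cstar_algebra \<Rightarrow> 'a" where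
  "re_part a = (1/2) *\<^sub>R (a + star a)"

text \<open>This is \<open>(a - star a) / (2 \<i>)\<close>, put as a real part so that its
  properties are instances of those of \<open>re_part\<close>.\<close>

definition im_part :: "'a::unital_cstar_algebra \<Rightarrow> 'a" where
  "im_part a = re_part (- \<i> *\<^sub>C a)"

lemma star_re_part: "star (re_part a) = re_part a"
  by (simp add: re_part_def star_scaleR star_add star_star add.commute)

lemma star_im_part: "star (im_part a) = im_part a"
  by (simp add: im_part_def star_re_part)

lemma re_im_part: "a = re_part a + \<i> *\<^sub>C im_part a"
proof -
  have "re_part a + \<i> *\<^sub>C im_part a = (1/2) *\<^sub>C (a + star a) + (1/2) *\<^sub>C (a - star a)"
  proof -
    have "star (- \<i> *\<^sub>C a) = \<i> *\<^sub>C star a" unfolding star_scaleC by simp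
    then have "\<i> *\<^sub>C im_part a = (1/2) *\<^sub>C (a - star a)"
      by (simp only: im_part_def re_part_def scaleR_scaleC scaleC_scaleC scaleC_add_right
          complex_vector.scale_right_diff_distrib) simp
    then show ?thesis by (simp add: re_part_def scaleR_scaleC)
  qed
  also have "\<dots> = a"
    by (simp add: scaleC_add_right[symmetric] scaleC_scaleC scaleR_2[symmetric] scaleR_scaleC scaleC_one)
  finally show ?thesis by simp
qed

lemma norm_re_part: "norm (re_part a) \<le> norm a"
  using norm_triangle_ineq[of a "star a"] by (simp add: re_part_def)

lemma norm_im_part: "norm (im_part a) \<le> norm a"
  using norm_re_part[of "- \<i> *\<^sub>C a"] by (simp add: im_part_def norm_scaleC)

lemma pos_functional_re_part: "pos_functional f \<Longrightarrow> f (re_part a) = Re (f a)"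
  by (simp add: re_part_def clinear_simps pos_functional_clinear pos_functional_star complex_eq_iff)

lemma pos_functional_im_part: "pos_functional f \<Longrightarrow> f (im_part a) = Im (f a)"
  by (simp add: im_part_def pos_functional_re_part clinear_simps pos_functional_clinear scaleC_complex_def)

lemma pos_functional_bound:
  assumes f: "pos_functional f"
  shows "norm (f a) \<le> 2 * Re (f 1) * norm a"
proof -
  have p: "0 \<le> Re (f 1)" using pos_functional_one[OF f] by (simp add: complex_nonneg_Reals_iff)
  have "\<bar>Re (f a)\<bar> \<le> Re (f 1) * norm a"
    using pos_functional_self_adjoint_bound(2)[OF f star_re_part[of a]]
      mult_left_mono[OF norm_re_part[of a] p]
    by (simp add: pos_functional_re_part[OF f])
  moreover have "\<bar>Im (f a)\<bar> \<le> Re (f 1) * norm a"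
    using pos_functional_self_adjoint_bound(2)[OF f star_im_part[of a]]
      mult_left_mono[OF norm_im_part[of a] p]
    by (simp add: pos_functional_im_part[OF f])
  ultimately show ?thesis using cmod_le[of "f a"] by linarith
qed

lemma pos_functional_bounded_clinear: "pos_functional f \<Longrightarrow> bounded_clinear f"
  by (rule bounded_clinearI[OF pos_functional_clinear pos_functional_bound])

lemma unital_star_homD:
  assumes "unital_star_hom f"
  shows "clinear f" "f 1 = 1" "f (x * y) = f x * f y" "f (star x) = star (f x)"
  using assms[unfolded unital_star_hom_def] by simp_all

text \<open>A homomorphism carries \<open>y * y + c * c = 1\<close>, with \<open>c\<close> commuting
  with \<open>y\<close>, into the target, where it bounds the image of a self-adjoint
  \<open>y\<close>. The C*-identity reduces the general case to \<open>star x * x\<close>.\<close>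

lemma star_hom_contractive:
  fixes f :: "'a::unital_cstar_algebra \<Rightarrow> 'b::unital_cstar_algebra"
  assumes f: "unital_star_hom f"
  shows "norm (f x) \<le> norm x"
proof -
  have lin: "clinear f" and f1: "f 1 = 1" and fm: "\<And>x y. f (x * y) = f x * f y"
    and fs: "\<And>x. f (star x) = star (f x)"
    by (fact unital_star_homD[OF f])+
  have unit: "norm (f y) \<le> 1" if y: "norm y \<le> 1" "star y = y" for y
  proof -
    have "norm (y * y) \<le> 1" using y norm_mult_ineq[of y y] by (smt (verit) mult_le_one norm_ge_zero)
    moreover have "star (y * y) = y * y" using y by (simp add: star_mult)
    ultimately obtain c where c: "star c = c" "c * c = 1 - y * y"
      and cy: "\<And>z. z * (y * y) = y * y * z \<Longrightarrow> z * c = c * z"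
      using sqrt_one_minus by blast
    have "f c * f c = 1 - f y * f y"
      using arg_cong[OF c(2), of f] by (simp add: fm clinear_diff[OF lin] f1)
    moreover have "f y * f c = f c * f y"
      using cy[of y] fm by (metis mult.assoc)
    ultimately show ?thesis
      using norm_le_of_commuting_squares[of "f y" "f c" 1] fs[of y] fs[of c] y c by simp
  qed
  have sa: "norm (f y) \<le> norm y" if "star y = y" for y
  proof (cases "y = 0")
    case True
    then show ?thesis by (simp add: clinear_zero[OF lin])
  next
    case False
    then show ?thesis
      using unit[of "(1 / norm y) *\<^sub>R y"] that
      by (simp add: star_scaleR clinear_scaleR[OF lin] field_simps)
  qed
  have "norm (f x) ^ 2 \<le> norm x ^ 2"
    using sa[of "star x * x"] cstar_identity[of x] cstar_identity[of "f x"]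
    by (simp add: fm fs star_mult star_star)
  then show ?thesis by simp
qed

lemma star_hom_bounded_clinear: "unital_star_hom f \<Longrightarrow> bounded_clinear f"
  using bounded_clinearI[of f 1, OF unital_star_homD(1)] star_hom_contractive[of f] by simp

text \<open>An abstract form of the vector functionals of a faithful representation: the closure
  condition corresponds to replacing the vector \<xi> by \<pi>(b)\<xi>. It keeps the order and norm
  arguments free of Hilbert spaces.\<close>

definition faithful_family :: "('a::unital_cstar_algebra \<Rightarrow> complex) set \<Rightarrow> bool" where
  "faithful_family N \<longleftrightarrow> (\<forall>\<omega>\<in>N. pos_functional \<omega>) \<and>
     (\<forall>\<omega>\<in>N. \<forall>b. (\<lambda>a. \<omega> (star b * a * b)) \<in> N) \<and> (\<forall>a. (\<forall>\<omega>\<in>N. \<omega> a = 0) \<longrightarrow> a = 0)"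

lemma faithful_family_pos: "faithful_family N \<Longrightarrow> \<omega> \<in> N \<Longrightarrow> pos_functional \<omega>"
  and faithful_family_conj: "faithful_family N \<Longrightarrow> \<omega> \<in> N \<Longrightarrow> (\<lambda>a. \<omega> (star b * a * b)) \<in> N"
  by (simp_all add: faithful_family_def)

lemma faithful_family_eq:
  assumes "faithful_family N" "\<And>\<omega>. \<omega> \<in> N \<Longrightarrow> \<omega> a = \<omega> b"
  shows "a = b"
proof -
  have "\<omega> (a - b) = 0" if "\<omega> \<in> N" for \<omega>
    using assms(2)[OF that] pos_functional_clinear[OF faithful_family_pos[OF assms(1) that]]
    by (simp add: clinear_diff)
  then have "a - b = 0" using assms(1) unfolding faithful_family_def by blast
  then show ?thesis by simp
qed

lemma self_adjoint_pow_eq_zero: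
  fixes n :: "'a::unital_cstar_algebra"
  assumes "star n = n" "n * n * n = 0"
  shows "n = 0"
proof -
  have "norm (n * n) ^ 2 = norm ((n * n) * (n * n))"
    using cstar_identity[of "n * n"] assms(1) by (simp add: star_mult)
  also have "(n * n) * (n * n) = 0" using assms(2) by (simp add: mult.assoc[symmetric])
  finally have "n * n = 0" by simp
  then show ?thesis using cstar_identity[of n] assms(1) by simp
qed

text \<open>With \<open>w = |x|\<close> and \<open>n = w - x\<close> one has \<open>n (w + x) n = 0\<close>; as \<open>\<omega>(n w n)\<close> and \<open>\<omega>(n x n)\<close> are
  nonnegative, both vanish, so \<open>n\<^sup>3 = 0\<close>.\<close>

lemma faithful_family_sqrt:
  fixes x :: "'a::unital_cstar_algebra"
  assumes N: "faithful_family N" and pos: "\<And>\<omega>. \<omega> \<in> N \<Longrightarrow> \<omega> x \<in> \<real>\<^sub>\<ge>\<^sub>0"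
  obtains s where "star s = s" "s * s = x" "\<And>z. z * x = x * z \<Longrightarrow> z * s = s * z"
proof -
  have sx: "star x = x"
  proof (rule faithful_family_eq[OF N])
    fix \<omega> assume "\<omega> \<in> N"
    then show "\<omega> (star x) = \<omega> x"
      using pos[of \<omega>] pos_functional_star[OF faithful_family_pos[OF N], of \<omega> x]
      by (auto simp: complex_nonneg_Reals_iff complex_eq_iff)
  qed
  show thesis
  proof (cases "x = 0")
    case True
    then show ?thesis using that[of 0] by simp
  next
    case False
    define M where "M = norm x"
    have M: "M > 0" using False by (simp add: M_def)
    define y where "y = (1 / M) *\<^sub>R x"
    have sy: "star y = y" and ny: "norm y \<le> 1"
      using M by (simp_all add: y_def star_scaleR sx) (simp add: M_def)
    have comm_y: "z * y = y * z" if "z * x = x * z" for z using that by (simp add: y_def)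
    \<comment> \<open>Roots are available for \<open>1 - z\<close> with \<open>z\<close>
      self-adjoint in the unit ball. The auxiliary root \<open>c\<close> shows that
      \<open>1 - y * y\<close> lies in that ball, so \<open>y * y = 1 - (1 - y * y)\<close> has a
      root \<open>w\<close>.\<close>
    have "norm (y * y) \<le> 1" using ny norm_mult_ineq[of y y] by (smt (verit) mult_le_one norm_ge_zero)
    moreover have syy: "star (y * y) = y * y" using sy by (simp add: star_mult)
    ultimately obtain c where c: "star c = c" "c * c = 1 - y * y"
      and cc: "\<And>z. z * (y * y) = y * y * z \<Longrightarrow> z * c = c * z"
      using sqrt_one_minus by blast
    have "c * y = y * c" using cc[of y] by (simp add: mult.assoc)
    then have "norm c \<le> 1"
      using norm_le_of_commuting_squares[of c y 1] c sy by simp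
    then have "norm (1 - y * y) \<le> 1"
      using norm_mult_ineq[of c c] c by (smt (verit) mult_le_one norm_ge_zero)
    moreover have "star (1 - y * y) = 1 - y * y" using syy by (simp add: star_diff)
    moreover have "1 - (1 - y * y) = y * y" by simp
    ultimately obtain w where w: "star w = w" "w * w = y * y" "norm (1 - w) \<le> 1"
      and wc: "\<And>z. z * (1 - y * y) = (1 - y * y) * z \<Longrightarrow> z * w = w * z"
      using sqrt_one_minus[of "1 - y * y"] by metis
    have comm_w: "z * w = w * z" if "z * y = y * z" for z
    proof (rule wc)
      have "z * (y * y) = y * y * z" using that by (metis mult.assoc)
      then show "z * (1 - y * y) = (1 - y * y) * z" by (simp add: algebra_simps)
    qed
    have "star (1 - w) = 1 - w" "1 - (1 - w) = w" using w by (simp_all add: star_diff)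
    \<comment> \<open>\<open>v\<close> exhibits \<open>w\<close> as positive, and once
      \<open>n = 0\<close> it is also the desired root of \<open>y\<close>.\<close>
    then obtain v where v: "star v = v" "v * v = w"
      and vc: "\<And>z. z * (1 - w) = (1 - w) * z \<Longrightarrow> z * v = v * z"
      using sqrt_one_minus[of "1 - w"] w(3) by metis
    have comm_v: "z * v = v * z" if "z * y = y * z" for z
      by (rule vc) (use comm_w[OF that] in \<open>simp add: algebra_simps\<close>)
    define n where "n = w - y"
    have sn: "star n = n" by (simp add: n_def star_diff w sy)
    have yw: "y * w = w * y" by (rule comm_w) simp
    have np: "n * (w + y) = 0" using yw w by (simp add: n_def algebra_simps)
    have "n * n * n = 0"
    proof (rule faithful_family_eq[OF N])
      fix \<omega> assume \<omega>: "\<omega> \<in> N"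
      have p: "pos_functional \<omega>" by (rule faithful_family_pos[OF N \<omega>])
      note lin = clinear_simps[OF pos_functional_clinear[OF p]]
      have "\<omega> (n * w * n) \<in> \<real>\<^sub>\<ge>\<^sub>0"
        using pos_functional_nonneg[OF p, of "v * n"] by (simp add: star_mult v sn mult.assoc flip: v(2))
      moreover have "\<omega> (n * y * n) \<in> \<real>\<^sub>\<ge>\<^sub>0"
      proof -
        have "\<omega> (n * x * n) \<in> \<real>\<^sub>\<ge>\<^sub>0"
          using pos[OF faithful_family_conj[OF N \<omega>, of n]] sn by simp
        then show ?thesis using M by (simp add: y_def lin complex_nonneg_Reals_iff)
      qed
      moreover have "\<omega> (n * w * n) + \<omega> (n * y * n) = 0"
      proof -
        have "n * w * n + n * y * n = n * (w + y) * n" by (simp add: algebra_simps)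
        then show ?thesis using np lin by (metis mult_zero_left)
      qed
      ultimately have "\<omega> (n * w * n) = 0" "\<omega> (n * y * n) = 0"
        by (auto simp: complex_nonneg_Reals_iff complex_eq_iff)
      moreover have "n * n * n = n * w * n - n * y * n"
        unfolding n_def by (simp add: algebra_simps)
      ultimately show "\<omega> (n * n * n) = \<omega> 0" by (simp add: lin)
    qed
    then have "n = 0" using sn by (rule self_adjoint_pow_eq_zero[rotated])
    then have "v * v = y" by (simp add: n_def v)
    then show ?thesis
      using M by (intro that[of "sqrt M *\<^sub>R v"]) (simp_all add: star_scaleR v y_def comm_v[OF comm_y])
  qed
qed

text \<open>The hypothesis makes \<open>r *\<^sub>R 1 - a\<close> and
  \<open>r *\<^sub>R 1 + a\<close> positive on \<open>N\<close>, so both have roots. These commute,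
  and their product squares to \<open>(r * r) *\<^sub>R 1 - a * a\<close>.\<close>

lemma faithful_family_norm_self_adjoint:
  fixes a :: "'a::unital_cstar_algebra"
  assumes N: "faithful_family N" and sa: "star a = a" and r: "0 \<le> r"
    and le: "\<And>\<omega>. \<omega> \<in> N \<Longrightarrow> norm (\<omega> a) \<le> r * Re (\<omega> 1)"
  shows "norm a \<le> r"
proof -
  have pos: "\<omega> (r *\<^sub>R 1 - a) \<in> \<real>\<^sub>\<ge>\<^sub>0" "\<omega> (r *\<^sub>R 1 + a) \<in> \<real>\<^sub>\<ge>\<^sub>0" if \<omega>: "\<omega> \<in> N" for \<omega>
  proof -
    have p: "pos_functional \<omega>" by (rule faithful_family_pos[OF N \<omega>])
    note lin = clinear_simps[OF pos_functional_clinear[OF p]]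
    have "Im (\<omega> a) = 0" "Im (\<omega> 1) = 0"
      using pos_functional_self_adjoint_bound(1)[OF p] sa by (simp_all add: complex_is_Real_iff)
    moreover have "\<bar>Re (\<omega> a)\<bar> \<le> r * Re (\<omega> 1)" using le[OF \<omega>] abs_Re_le_cmod[of "\<omega> a"] by linarith
    ultimately show "\<omega> (r *\<^sub>R 1 - a) \<in> \<real>\<^sub>\<ge>\<^sub>0" "\<omega> (r *\<^sub>R 1 + a) \<in> \<real>\<^sub>\<ge>\<^sub>0"
      by (auto simp: lin complex_nonneg_Reals_iff)
  qed
  obtain s where s: "star s = s" "s * s = r *\<^sub>R 1 - a"
    and sc: "\<And>z. z * (r *\<^sub>R 1 - a) = (r *\<^sub>R 1 - a) * z \<Longrightarrow> z * s = s * z"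
    using faithful_family_sqrt[OF N, of "r *\<^sub>R 1 - a"] pos(1) by metis
  obtain s' where s': "star s' = s'" "s' * s' = r *\<^sub>R 1 + a"
    and sc': "\<And>z. z * (r *\<^sub>R 1 + a) = (r *\<^sub>R 1 + a) * z \<Longrightarrow> z * s' = s' * z"
    using faithful_family_sqrt[OF N, of "r *\<^sub>R 1 + a"] pos(2) by metis
  have as: "a * s = s * a" by (rule sc) (simp add: algebra_simps)
  have as': "a * s' = s' * a" by (rule sc') (simp add: algebra_simps)
  have ss: "s' * s = s * s'" by (rule sc) (simp add: algebra_simps as')
  have "a * (s * s') = (s * s') * a" by (metis as as' mult.assoc)
  moreover have "star (s * s') = s * s'" by (simp add: star_mult s s' ss)
  moreover have "(s * s') * (s * s') = (s * s) * (s' * s')" by (metis mult.assoc ss)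
  then have "a * a + (s * s') * (s * s') = (r * r) *\<^sub>R 1"
    unfolding s s' by (simp add: algebra_simps)
  ultimately show ?thesis using norm_le_of_commuting_squares[OF sa] r by blast
qed

lemma faithful_family_norm:
  fixes a :: "'a::unital_cstar_algebra"
  assumes N: "faithful_family N" and r: "0 \<le> r"
    and le: "\<And>\<omega>. \<omega> \<in> N \<Longrightarrow> norm (\<omega> a) \<le> r * Re (\<omega> 1)"
  shows "norm a \<le> 2 * r"
proof -
  have "norm (re_part a) \<le> r"
  proof (rule faithful_family_norm_self_adjoint[OF N star_re_part r])
    fix \<omega> assume \<omega>: "\<omega> \<in> N"
    show "norm (\<omega> (re_part a)) \<le> r * Re (\<omega> 1)"
      using le[OF \<omega>] abs_Re_le_cmod[of "\<omega> a"]
      by (simp add: pos_functional_re_part[OF faithful_family_pos[OF N \<omega>]])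
  qed
  moreover have "norm (im_part a) \<le> r"
  proof (rule faithful_family_norm_self_adjoint[OF N star_im_part r])
    fix \<omega> assume \<omega>: "\<omega> \<in> N"
    show "norm (\<omega> (im_part a)) \<le> r * Re (\<omega> 1)"
      using le[OF \<omega>] abs_Im_le_cmod[of "\<omega> a"]
      by (simp add: pos_functional_im_part[OF faithful_family_pos[OF N \<omega>]])
  qed
  ultimately show ?thesis
    using norm_triangle_ineq[of "re_part a" "\<i> *\<^sub>C im_part a"]
    by (simp add: norm_scaleC flip: re_im_part)
qed

section \<open>Vector functionals on \<open>\<ell>\<^sup>2(I)\<close>\<close>

lemma ell2_summable: "(\<lambda>i. cnj (ell2_apply x i) * ell2_apply y i) summable_on UNIV"
proof -
  have s: "(\<lambda>i. (cmod (ell2_apply v i))\<^sup>2) summable_on UNIV" for v :: "'a ell2"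
    using ell2_apply[of v] by simp
  have "(\<lambda>i. norm (cnj (ell2_apply x i) * ell2_apply y i)) summable_on UNIV"
    by (rule abs_summable_product)
      (use s[of x] s[of y] in \<open>simp_all add: norm_mult power2_eq_square\<close>)
  then show ?thesis by (rule abs_summable_summable)
qed

lemma ell2_inner_add_right: "ell2_inner x (y + z) = ell2_inner x y + ell2_inner x z"
  unfolding ell2_inner.rep_eq plus_ell2.rep_eq
  by (simp add: distrib_left infsum_add ell2_summable)

lemma ell2_inner_scaleC_right: "ell2_inner x (c *\<^sub>C y) = c * ell2_inner x y"
  unfolding ell2_inner.rep_eq scaleC_ell2.rep_eq
  by (simp add: mult.left_commute[of _ c] infsum_cmult_right')

lemma ell2_inner_commute: "ell2_inner y x = cnj (ell2_inner x y)"
  unfolding ell2_inner.rep_eq by (simp add: infsum_cnj[symmetric] mult.commute)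

lemma ell2_inner_add_left: "ell2_inner (x + y) z = ell2_inner x z + ell2_inner y z"
  by (metis ell2_inner_commute ell2_inner_add_right complex_cnj_add)

lemma ell2_inner_scaleC_left: "ell2_inner (c *\<^sub>C x) y = cnj c * ell2_inner x y"
  by (metis ell2_inner_commute ell2_inner_scaleC_right complex_cnj_mult)

lemma ell2_inner_zero_right [simp]: "ell2_inner x 0 = 0"
  using ell2_inner_scaleC_right[of x 0 0] by simp

lemma ell2_inner_self: "ell2_inner x x \<in> \<real>\<^sub>\<ge>\<^sub>0"
proof -
  have "(\<lambda>i. (cmod (ell2_apply x i))\<^sup>2) summable_on UNIV"
    using ell2_apply[of x] by simp
  then have "((\<lambda>i. complex_of_real ((cmod (ell2_apply x i))\<^sup>2))
      has_sum of_real (\<Sum>\<^sub>\<infinity>i. (cmod (ell2_apply x i))\<^sup>2)) UNIV"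
    by (intro has_sum_of_real has_sum_infsum)
  moreover have "complex_of_real ((cmod (ell2_apply x i))\<^sup>2) = cnj (ell2_apply x i) * ell2_apply x i" for i
    by (simp add: complex_norm_square mult.commute del: of_real_power)
  ultimately have "ell2_inner x x = of_real (\<Sum>\<^sub>\<infinity>i. (cmod (ell2_apply x i))\<^sup>2)"
    unfolding ell2_inner.rep_eq by (simp add: infsumI)
  then show ?thesis by (simp add: infsum_nonneg)
qed

lemma ell2_inner_tensor:
  "ell2_inner (ell2_tensor x y) (ell2_tensor x' y') = ell2_inner x x' * ell2_inner y y'"
proof -
  define f where "f i j = (cnj (ell2_apply x i) * ell2_apply x' i) * (cnj (ell2_apply y j) * ell2_apply y' j)"
    for i j
  have f: "(\<lambda>p. cnj (ell2_apply (ell2_tensor x y) p) * ell2_apply (ell2_tensor x' y') p) = (\<lambda>(i, j). f i j)"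
    by (auto simp: ell2_tensor.rep_eq f_def)
  have "(\<lambda>(i, j). f i j) summable_on UNIV \<times> UNIV"
    using ell2_summable[of "ell2_tensor x y" "ell2_tensor x' y'"] unfolding f by simp
  then have "(\<Sum>\<^sub>\<infinity>i. \<Sum>\<^sub>\<infinity>j. f i j) = (\<Sum>\<^sub>\<infinity>(i, j)\<in>UNIV \<times> UNIV. f i j)"
    by (rule infsum_Sigma'_banach)
  moreover have "(\<Sum>\<^sub>\<infinity>i. \<Sum>\<^sub>\<infinity>j. f i j) = ell2_inner x x' * ell2_inner y y'"
    unfolding ell2_inner.rep_eq by (simp add: f_def infsum_cmult_right' infsum_cmult_left')
  ultimately show ?thesis unfolding ell2_inner.rep_eq f by simp
qed

section \<open>Basis vectors and elementary tensors\<close>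

lift_definition ell2_basis :: "'i \<Rightarrow> 'i ell2" is "\<lambda>i j. if j = i then 1 else 0"
proof -
  fix i :: 'i
  have "(\<lambda>j. (cmod (if j = i then 1 else 0))\<^sup>2) summable_on {i}" by simp
  then show "(\<lambda>j. (cmod (if j = i then 1 else 0))\<^sup>2) summable_on UNIV"
    by (rule summable_on_cong_neutral[THEN iffD1, rotated -1]) auto
qed

lemma ell2_inner_basis: "ell2_inner (ell2_basis i) x = ell2_apply x i"
proof -
  have "(\<Sum>\<^sub>\<infinity>j. cnj (if j = i then 1 else 0) * ell2_apply x j) = (\<Sum>\<^sub>\<infinity>j\<in>{i}. ell2_apply x j)"
    by (rule infsum_cong_neutral) auto
  then show ?thesis unfolding ell2_inner.rep_eq ell2_basis.rep_eq by simp
qed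

lemma ell2_tensor_basis: "ell2_tensor (ell2_basis i) (ell2_basis j) = ell2_basis (i, j)"
  by transfer auto

lemma ell2_eqI:
  assumes "\<And>i. ell2_inner (ell2_basis i) x = ell2_inner (ell2_basis i) y"
  shows "x = y"
  using assms by (simp add: ell2_inner_basis ell2_apply_inject[symmetric] fun_eq_iff)

lemma ell2_tensor_add_left: "ell2_tensor (x + x') y = ell2_tensor x y + ell2_tensor x' y"
  and ell2_tensor_add_right: "ell2_tensor x (y + y') = ell2_tensor x y + ell2_tensor x y'"
  and ell2_tensor_scaleC_left: "ell2_tensor (c *\<^sub>C x) y = c *\<^sub>C ell2_tensor x y"
  and ell2_tensor_scaleC_right: "ell2_tensor x (c *\<^sub>C y) = c *\<^sub>C ell2_tensor x y"
  by (transfer, simp add: algebra_simps)+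

section \<open>Representations and their vector functionals\<close>

lemma representation_clinear: "representation \<pi> \<Longrightarrow> clinear (\<pi> a)"
  by (simp add: representation_def bounded_clinear_def)

lemma representation_add: "representation \<pi> \<Longrightarrow> \<pi> (a + b) \<xi> = \<pi> a \<xi> + \<pi> b \<xi>"
  and representation_scaleC: "representation \<pi> \<Longrightarrow> \<pi> (c *\<^sub>C a) \<xi> = c *\<^sub>C \<pi> a \<xi>"
  and representation_mult: "representation \<pi> \<Longrightarrow> \<pi> (a * b) \<xi> = \<pi> a (\<pi> b \<xi>)"
  and representation_one: "representation \<pi> \<Longrightarrow> \<pi> 1 \<xi> = \<xi>"
  unfolding representation_def by blast+

lemma representation_star_left:
  "representation \<pi> \<Longrightarrow> ell2_inner (\<pi> (star a) \<xi>) \<eta> = ell2_inner \<xi> (\<pi> a \<eta>)"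
  unfolding representation_def by blast

lemma representation_star_right:
  "representation \<pi> \<Longrightarrow> ell2_inner \<xi> (\<pi> (star a) \<eta>) = ell2_inner (\<pi> a \<xi>) \<eta>"
  using representation_star_left[of \<pi> "star a" \<xi> \<eta>] by (simp add: star_star)

definition vector_functional ::
    "('a::unital_cstar_algebra \<Rightarrow> 'i ell2 \<Rightarrow> 'i ell2) \<Rightarrow> 'i ell2 \<Rightarrow> 'a \<Rightarrow> complex" where
  "vector_functional \<pi> \<xi> a = ell2_inner \<xi> (\<pi> a \<xi>)"

lemma pos_functional_vector_functional:
  assumes "representation \<pi>"
  shows "pos_functional (vector_functional \<pi> \<xi>)"
  unfolding pos_functional_def clinear_def vector_functional_def
  by (simp add: representation_add[OF assms] representation_scaleC[OF assms]
      representation_mult[OF assms] representation_star_right[OF assms]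
      ell2_inner_add_right ell2_inner_scaleC_right ell2_inner_self scaleC_complex_def)

lemma ell2_polarization:
  fixes T :: "'i ell2 \<Rightarrow> 'i ell2"
  assumes lin: "clinear T" and z: "\<And>\<xi>. ell2_inner \<xi> (T \<xi>) = 0"
  shows "T \<eta> = 0"
proof (rule ell2_eqI)
  fix i :: 'i
  define e where "e = ell2_basis i"
  have "c * ell2_inner e (T \<eta>) + cnj c * ell2_inner \<eta> (T e) = 0" for c
    using z[of "e + c *\<^sub>C \<eta>"] z[of e] z[of \<eta>]
    by (simp add: clinear_add[OF lin] clinear_scaleC[OF lin] ell2_inner_add_left
        ell2_inner_add_right ell2_inner_scaleC_left ell2_inner_scaleC_right add.commute)
  \<comment> \<open>The sum and the difference of the two cross terms vanish.\<close>
  from this[of 1] this[of \<i>] show "ell2_inner (ell2_basis i) (T \<eta>) = ell2_inner (ell2_basis i) 0"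
    by (simp add: e_def[symmetric])
qed

lemma faithful_family_vector_functionals:
  assumes \<pi>: "representation \<pi>" and inj: "inj \<pi>"
  shows "faithful_family (range (vector_functional \<pi>))"
  unfolding faithful_family_def
proof (intro conjI ballI allI impI)
  fix \<omega> assume "\<omega> \<in> range (vector_functional \<pi>)"
  then obtain \<xi> where \<xi>: "\<omega> = vector_functional \<pi> \<xi>" by blast
  then show "pos_functional \<omega>" using \<pi> by (simp add: pos_functional_vector_functional)
  fix b
  have "(\<lambda>a. \<omega> (star b * a * b)) = vector_functional \<pi> (\<pi> b \<xi>)"
    by (simp add: \<xi> vector_functional_def fun_eq_iff representation_mult[OF \<pi>]
        representation_star_right[OF \<pi>])
  then show "(\<lambda>a. \<omega> (star b * a * b)) \<in> range (vector_functional \<pi>)" by simp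
next
  fix a assume "\<forall>\<omega>\<in>range (vector_functional \<pi>). \<omega> a = 0"
  then have "\<pi> a \<eta> = 0" for \<eta>
    by (intro ell2_polarization[OF representation_clinear[OF \<pi>]]) (auto simp: vector_functional_def)
  moreover have "\<pi> 0 \<eta> = 0" for \<eta>
    using representation_scaleC[OF \<pi>, of 0 0 \<eta>] by simp
  ultimately have "\<pi> a = \<pi> 0" by (simp add: fun_eq_iff)
  then show "a = 0" using inj by (simp add: inj_eq)
qed

section \<open>Spatial tensor products\<close>

text \<open>All that the later proof uses of a minimal tensor product.
  \<open>product_functionals\<close> retains enough of the spatial norm to construct slices, and in
  this abstract form the whole list survives an exchange of the factors.\<close>

locale cstar_tensor =
  fixes t :: "'a::unital_cstar_algebra \<Rightarrow> 'b::unital_cstar_algebra \<Rightarrow> 'c::unital_cstar_algebra"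
  assumes add_left: "t (a + a') b = t a b + t a' b"
    and add_right: "t a (b + b') = t a b + t a b'"
    and scaleC_left: "t (c *\<^sub>C a) b = c *\<^sub>C t a b"
    and scaleC_right: "t a (c *\<^sub>C b) = c *\<^sub>C t a b"
    and mult: "t a b * t a' b' = t (a * a') (b * b')"
    and star: "star (t a b) = t (star a) (star b)"
    and one: "t 1 1 = 1"
    and dense: "closure (complex_vector.span {t a b | a b. True}) = UNIV"
    and product_functionals: "\<exists>N M. faithful_family N \<and> faithful_family M \<and>
      (\<forall>\<phi>\<in>N. \<forall>\<psi>\<in>M. \<exists>\<theta>. pos_functional \<theta> \<and> (\<forall>a b. \<theta> (t a b) = \<phi> a * \<psi> b))"

text \<open>Basis vectors are elementary tensors, so the operator of \<open>z = x - y\<close> kills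
  them. Testing the adjoint against basis vectors shows that it is zero, which avoids a density
  argument in the Hilbert space.\<close>

lemma representation_eqI:
  fixes \<rho> :: "'c::unital_cstar_algebra \<Rightarrow> ('i \<times> 'j) ell2 \<Rightarrow> ('i \<times> 'j) ell2"
  assumes \<rho>: "representation \<rho>" and iso: "\<And>x. onorm (\<rho> x) = norm x"
    and eq: "\<And>\<xi> \<eta>. \<rho> x (ell2_tensor \<xi> \<eta>) = \<rho> y (ell2_tensor \<xi> \<eta>)"
  shows "x = y"
proof -
  define z where "z = x - y"
  have z0: "\<rho> z (ell2_tensor \<xi> \<eta>) = 0" for \<xi> \<eta>
    using representation_add[OF \<rho>, of z y] eq by (simp add: z_def)
  have "\<rho> (star z) \<zeta> = 0" for \<zeta>
  proof (rule ell2_eqI)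
    fix p :: "'i \<times> 'j"
    have "ell2_inner (ell2_basis p) (\<rho> (star z) \<zeta>) = ell2_inner (\<rho> z (ell2_basis p)) \<zeta>"
      by (rule representation_star_right[OF \<rho>])
    also have "\<rho> z (ell2_basis p) = 0"
      using z0[of "ell2_basis (fst p)" "ell2_basis (snd p)"] by (simp add: ell2_tensor_basis)
    finally show "ell2_inner (ell2_basis p) (\<rho> (star z) \<zeta>) = ell2_inner (ell2_basis p) 0"
      using ell2_inner_commute[of 0 \<zeta>] by simp
  qed
  then have "\<rho> (star z) = (\<lambda>_. 0)" by (simp add: fun_eq_iff)
  then have "norm (star z) = 0" using iso[of "star z"] by (simp add: onorm_zero[where ?'a = "('i \<times> 'j) ell2"])
  then show ?thesis by (simp add: z_def)
qed

lemma cstar_tensor_min_tensor: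
  fixes t :: "'a::unital_cstar_algebra \<Rightarrow> 'b::unital_cstar_algebra \<Rightarrow> 'c::unital_cstar_algebra"
  assumes "min_tensor t"
  shows "cstar_tensor t"
proof -
  from assms obtain \<pi> :: "'a \<Rightarrow> 'a ell2 \<Rightarrow> 'a ell2" and \<sigma> :: "'b \<Rightarrow> 'b ell2 \<Rightarrow> 'b ell2"
      and \<rho> :: "'c \<Rightarrow> ('a \<times> 'b) ell2 \<Rightarrow> ('a \<times> 'b) ell2"
    where d: "closure (complex_vector.span {t a b | a b. True}) = UNIV"
      and \<pi>: "representation \<pi>" "inj \<pi>" and \<sigma>: "representation \<sigma>" "inj \<sigma>"
      and \<rho>: "representation \<rho>" and iso: "\<And>x. onorm (\<rho> x) = norm x"
      and t: "\<And>a b \<xi> \<eta>. \<rho> (t a b) (ell2_tensor \<xi> \<eta>) = ell2_tensor (\<pi> a \<xi>) (\<sigma> b \<eta>)"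
    unfolding min_tensor_def by blast
  note eqI = representation_eqI[OF \<rho> iso]
  note reps = t representation_add[OF \<pi>(1)] representation_add[OF \<sigma>(1)] representation_add[OF \<rho>]
    representation_scaleC[OF \<pi>(1)] representation_scaleC[OF \<sigma>(1)] representation_scaleC[OF \<rho>]
    representation_mult[OF \<pi>(1)] representation_mult[OF \<sigma>(1)] representation_mult[OF \<rho>]
    representation_one[OF \<pi>(1)] representation_one[OF \<sigma>(1)] representation_one[OF \<rho>]
    ell2_tensor_add_left ell2_tensor_add_right ell2_tensor_scaleC_left ell2_tensor_scaleC_right
  show ?thesis
  proof
    fix a a' :: 'a and b b' :: 'b and c
    show "t (a + a') b = t a b + t a' b" by (rule eqI) (simp add: reps)
    show "t a (b + b') = t a b + t a b'" by (rule eqI) (simp add: reps)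
    show "t (c *\<^sub>C a) b = c *\<^sub>C t a b" by (rule eqI) (simp add: reps)
    show "t a (c *\<^sub>C b) = c *\<^sub>C t a b" by (rule eqI) (simp add: reps)
    show "t a b * t a' b' = t (a * a') (b * b')" by (rule eqI) (simp add: reps)
    show "t 1 1 = 1" by (rule eqI) (simp add: reps)
    \<comment> \<open>Adjoints are only described by the inner product, hence the comparison against
      basis vectors.\<close>
    show "star (t a b) = t (star a) (star b)"
    proof (rule eqI, rule ell2_eqI)
      fix \<xi> \<eta> and p :: "'a \<times> 'b"
      obtain i j where p: "ell2_basis p = ell2_tensor (ell2_basis i) (ell2_basis j)"
        by (cases p) (simp add: ell2_tensor_basis)
      show "ell2_inner (ell2_basis p) (\<rho> (star (t a b)) (ell2_tensor \<xi> \<eta>))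
          = ell2_inner (ell2_basis p) (\<rho> (t (star a) (star b)) (ell2_tensor \<xi> \<eta>))"
        by (simp add: p representation_star_right[OF \<rho>] t ell2_inner_tensor
            representation_star_right[OF \<pi>(1)] representation_star_right[OF \<sigma>(1)])
    qed
  next
    show "closure (complex_vector.span {t a b | a b. True}) = UNIV" by (rule d)
  next
    have "\<exists>\<theta>. pos_functional \<theta> \<and>
        (\<forall>a b. \<theta> (t a b) = vector_functional \<pi> \<xi> a * vector_functional \<sigma> \<eta> b)" for \<xi> \<eta>
      by (rule exI[of _ "vector_functional \<rho> (ell2_tensor \<xi> \<eta>)"])
        (simp add: pos_functional_vector_functional[OF \<rho>] vector_functional_def t ell2_inner_tensor)
    then show "\<exists>N M. faithful_family N \<and> faithful_family M \<and>
      (\<forall>\<phi>\<in>N. \<forall>\<psi>\<in>M. \<exists>\<theta>. pos_functional \<theta> \<and> (\<forall>a b. \<theta> (t a b) = \<phi> a * \<psi> b))"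
      using faithful_family_vector_functionals[OF \<pi>] faithful_family_vector_functionals[OF \<sigma>]
      by blast
  qed
qed

lemma cstar_tensor_flip:
  assumes "cstar_tensor t"
  shows "cstar_tensor (\<lambda>b a. t a b)"
proof -
  interpret cstar_tensor t by (rule assms)
  obtain N M where *: "faithful_family N" "faithful_family M"
      "\<And>\<phi> \<psi>. \<phi> \<in> N \<Longrightarrow> \<psi> \<in> M \<Longrightarrow> \<exists>\<theta>. pos_functional \<theta> \<and> (\<forall>a b. \<theta> (t a b) = \<phi> a * \<psi> b)"
    using product_functionals by blast
  have "\<exists>\<theta>. pos_functional \<theta> \<and> (\<forall>b a. \<theta> (t a b) = \<psi> b * \<phi> a)" if "\<phi> \<in> N" "\<psi> \<in> M" for \<phi> \<psi>
    using *(3)[OF that] by (auto simp: mult.commute)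
  then have "\<exists>N M. faithful_family N \<and> faithful_family M \<and>
      (\<forall>\<phi>\<in>N. \<forall>\<psi>\<in>M. \<exists>\<theta>. pos_functional \<theta> \<and> (\<forall>b a. \<theta> (t a b) = \<phi> b * \<psi> a))"
    using *(1,2) by blast
  moreover have "{t b a | a b. True} = {t a b | a b. True}" by blast
  then have "closure (complex_vector.span {t b a | a b. True}) = UNIV"
    using dense by (rule ssubst)
  ultimately show ?thesis
    by (intro cstar_tensor.intro add_left add_right scaleC_left scaleC_right mult star one)
qed

section \<open>Slice maps\<close>

lemma clinear_subspace_eq:
  assumes "clinear f" "clinear g"
  shows "complex_vector.subspace {x. f x = g x}"
  using assms by (intro complex_vector.subspaceI) (simp_all add: clinear_simps)

lemma bounded_clinear_continuous: "bounded_clinear f \<Longrightarrow> continuous_on A f"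
  by (simp add: bounded_clinear_bounded_linear linear_continuous_on)

lemma dense_subspace:
  fixes T :: "'a::{complex_vector,real_normed_vector} set"
  assumes "closure (complex_vector.span T) = UNIV" "T \<subseteq> V" "complex_vector.subspace V" "closed V"
  shows "x \<in> V"
proof -
  have "complex_vector.span T \<subseteq> V" using assms(2,3) by (rule complex_vector.span_minimal)
  then have "closure (complex_vector.span T) \<subseteq> V" using assms(4) by (rule closure_minimal)
  then show ?thesis using assms(1) by blast
qed

lemma bounded_clinear_eq_on_dense:
  assumes "closure (complex_vector.span T) = UNIV" "bounded_clinear f" "bounded_clinear g"
    and "\<And>x. x \<in> T \<Longrightarrow> f x = g x"
  shows "f x = g x"
proof -
  have "x \<in> {x. f x = g x}"
    using assms(1)
  proof (rule dense_subspace)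
    show "closed {x. f x = g x}"
      by (intro closed_Collect_eq bounded_clinear_continuous assms)
  qed (use assms in \<open>auto intro: clinear_subspace_eq bounded_clinear_clinear\<close>)
  then show ?thesis by simp
qed

lemma bounded_clinear_mult_left:
  fixes f :: "'a::{complex_vector,real_normed_vector} \<Rightarrow> 'b::unital_cstar_algebra"
  assumes "bounded_clinear f"
  shows "bounded_clinear (\<lambda>x. c * f x)"
  using assms
  by (simp add: bounded_clinear_def clinear_def distrib_left mult_scaleC_right bounded_linear_const_mult)

lemma bounded_clinear_mult_right:
  fixes f :: "'a::{complex_vector,real_normed_vector} \<Rightarrow> 'b::unital_cstar_algebra"
  assumes "bounded_clinear f"
  shows "bounded_clinear (\<lambda>x. f x * c)"
  using assms
  by (simp add: bounded_clinear_def clinear_def distrib_right mult_scaleC_left bounded_linear_mult_const)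

lemma bounded_clinear_diff:
  assumes "bounded_clinear f" "bounded_clinear g"
  shows "bounded_clinear (\<lambda>x. f x - g x)"
  using assms
  by (simp add: bounded_clinear_def clinear_def bounded_linear_sub complex_vector.scale_right_diff_distrib)

lemma bounded_clinear_scaleC:
  fixes f :: "'a::{complex_vector,real_normed_vector} \<Rightarrow> 'b::unital_cstar_algebra"
  assumes "bounded_clinear f"
  shows "bounded_clinear (\<lambda>x. c *\<^sub>C f x)"
  using bounded_clinear_mult_left[OF assms, of "c *\<^sub>C 1"] by (simp add: mult_scaleC_left)

lemma bounded_clinear_ident: "bounded_clinear (\<lambda>x. x)"
  by (simp add: bounded_clinear_def clinear_def)

text \<open>The two conjugations cancel, so that maps compared through adjoints are still accessible
  to uniqueness by density.\<close>

lemma bounded_clinear_star_star: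
  fixes f :: "'a::unital_cstar_algebra \<Rightarrow> 'b::unital_cstar_algebra"
  assumes "bounded_clinear f"
  shows "bounded_clinear (\<lambda>x. star (f (star x)))"
  using assms bounded_linear_compose[OF bounded_linear_star
      bounded_linear_compose[OF bounded_clinear_bounded_linear[OF assms] bounded_linear_star]]
  by (simp add: bounded_clinear_def clinear_def star_add star_scaleC)

text \<open>The values \<open>g \<omega> x\<close> determine at most one element \<open>S x\<close>,
  whose norm \<open>faithful_family_norm\<close> controls (hence the factor 2). So the
  \<open>x\<close> for which it exists form a closed subspace, and this contains
  \<open>T\<close>.\<close>

lemma dual_extension:
  fixes g :: "('a::unital_cstar_algebra \<Rightarrow> complex) \<Rightarrow> 'c::unital_cstar_algebra \<Rightarrow> complex"
  assumes N: "faithful_family N" and dense: "closure (complex_vector.span T) = UNIV"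
    and lin: "\<And>\<omega>. \<omega> \<in> N \<Longrightarrow> clinear (g \<omega>)" and K: "0 \<le> K"
    and bd: "\<And>\<omega> x. \<omega> \<in> N \<Longrightarrow> norm (g \<omega> x) \<le> K * Re (\<omega> 1) * norm x"
    and T: "\<And>x. x \<in> T \<Longrightarrow> \<exists>a. \<forall>\<omega>\<in>N. \<omega> a = g \<omega> x"
  obtains S where "bounded_clinear S" "\<And>\<omega> x. \<omega> \<in> N \<Longrightarrow> \<omega> (S x) = g \<omega> x"
    "\<And>x. norm (S x) \<le> 2 * K * norm x"
proof -
  note Nlin = pos_functional_clinear[OF faithful_family_pos[OF N]]
  have bound: "norm a \<le> 2 * K * norm x" if a: "\<And>\<omega>. \<omega> \<in> N \<Longrightarrow> \<omega> a = g \<omega> x" for a x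
  proof -
    have "norm a \<le> 2 * (K * norm x)"
    proof (rule faithful_family_norm[OF N])
      show "norm (\<omega> a) \<le> K * norm x * Re (\<omega> 1)" if "\<omega> \<in> N" for \<omega>
        using bd[OF that, of x] by (simp add: a[OF that] mult_ac)
    qed (simp add: K)
    then show ?thesis by simp
  qed
  define V where "V = {x. \<exists>a. \<forall>\<omega>\<in>N. \<omega> a = g \<omega> x}"
  have "x \<in> V" for x
    using dense
  proof (rule dense_subspace)
    show "T \<subseteq> V" using T by (auto simp: V_def)
    show "complex_vector.subspace V"
    proof (rule complex_vector.subspaceI)
      show "0 \<in> V" unfolding V_def using lin Nlin by (auto intro!: exI[of _ 0] simp: clinear_zero)
    next
      fix x y assume "x \<in> V" "y \<in> V"
      then obtain a b where "\<forall>\<omega>\<in>N. \<omega> a = g \<omega> x" "\<forall>\<omega>\<in>N. \<omega> b = g \<omega> y" by (auto simp: V_def)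
      then have "\<forall>\<omega>\<in>N. \<omega> (a + b) = g \<omega> (x + y)" by (simp add: clinear_add lin Nlin)
      then show "x + y \<in> V" unfolding V_def by blast
    next
      fix c x assume "x \<in> V"
      then obtain a where "\<forall>\<omega>\<in>N. \<omega> a = g \<omega> x" by (auto simp: V_def)
      then have "\<forall>\<omega>\<in>N. \<omega> (c *\<^sub>C a) = g \<omega> (c *\<^sub>C x)" by (simp add: clinear_scaleC lin Nlin)
      then show "c *\<^sub>C x \<in> V" unfolding V_def by blast
    qed
    show "closed V"
      unfolding closed_sequential_limits
    proof (intro allI impI)
      fix x l assume x: "(\<forall>n. x n \<in> V) \<and> x \<longlonglongrightarrow> l"
      then have "\<forall>n. \<exists>a. \<forall>\<omega>\<in>N. \<omega> a = g \<omega> (x n)" by (simp add: V_def)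
      then obtain a where a: "\<And>n \<omega>. \<omega> \<in> N \<Longrightarrow> \<omega> (a n) = g \<omega> (x n)" by metis
      have le: "norm (a m - a n) \<le> 2 * K * norm (x m - x n)" for m n
        by (rule bound) (simp add: clinear_diff Nlin lin a)
      have "Cauchy a"
      proof (rule CauchyI)
        fix e :: real assume e: "0 < e"
        have "Cauchy x" using x LIMSEQ_imp_Cauchy by blast
        \<comment> \<open>\<open>2 * K + 1\<close> keeps the divisor positive when
          \<open>K = 0\<close>.\<close>
        then obtain M where M: "\<And>m n. m \<ge> M \<Longrightarrow> n \<ge> M \<Longrightarrow> norm (x m - x n) < e / (2 * K + 1)"
          using CauchyD[of x "e / (2 * K + 1)"] e K by auto
        have "norm (a m - a n) < e" if "m \<ge> M" "n \<ge> M" for m n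
        proof -
          have "norm (a m - a n) \<le> (2 * K + 1) * norm (x m - x n)"
            using le[of m n] norm_ge_zero[of "x m - x n"] unfolding distrib_right by linarith
          also have "\<dots> < e" using M[OF that] K by (simp add: field_simps)
          finally show ?thesis .
        qed
        then show "\<exists>M. \<forall>m\<ge>M. \<forall>n\<ge>M. norm (a m - a n) < e" by blast
      qed
      then obtain b where b: "a \<longlonglongrightarrow> b" using Cauchy_convergent convergent_def by blast
      have "\<omega> b = g \<omega> l" if \<omega>: "\<omega> \<in> N" for \<omega>
      proof (rule LIMSEQ_unique)
        show "(\<lambda>n. \<omega> (a n)) \<longlonglongrightarrow> \<omega> b"
          by (rule bounded_linear.tendsto[OF bounded_clinear_bounded_linear[OF
                pos_functional_bounded_clinear[OF faithful_family_pos[OF N \<omega>]]] b])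
        have "bounded_clinear (g \<omega>)" by (rule bounded_clinearI[OF lin[OF \<omega>] bd[OF \<omega>]])
        then have "(\<lambda>n. g \<omega> (x n)) \<longlonglongrightarrow> g \<omega> l"
          by (rule bounded_linear.tendsto[OF bounded_clinear_bounded_linear conjunct2[OF x]])
        then show "(\<lambda>n. \<omega> (a n)) \<longlonglongrightarrow> g \<omega> l" by (simp only: a[OF \<omega>])
      qed
      then show "l \<in> V" by (auto simp: V_def)
    qed
  qed
  then have "\<forall>x. \<exists>a. \<forall>\<omega>\<in>N. \<omega> a = g \<omega> x" by (simp add: V_def)
  from choice[OF this] obtain S where "\<forall>x. \<forall>\<omega>\<in>N. \<omega> (S x) = g \<omega> x" ..
  then have S: "\<omega> (S x) = g \<omega> x" if "\<omega> \<in> N" for \<omega> x using that by simp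
  have "clinear S"
    unfolding clinear_def
    by (intro conjI allI; rule faithful_family_eq[OF N])
      (simp_all add: clinear_add clinear_scaleC Nlin lin S)
  moreover have nS: "norm (S x) \<le> 2 * K * norm x" for x
    by (rule bound) (rule S)
  ultimately have "bounded_clinear S" by (rule bounded_clinearI)
  then show thesis using that S nS by blast
qed

context cstar_tensor
begin

lemma tensor_ext:
  assumes "bounded_clinear f" "bounded_clinear g" "\<And>a b. f (t a b) = g (t a b)"
  shows "f x = g x"
  by (rule bounded_clinear_eq_on_dense[OF dense assms(1,2)]) (use assms(3) in auto)

text \<open>In \<open>t a b = t a 1 * t 1 b\<close> the second factor is a unital homomorphism in
  \<open>b\<close>, hence contractive.\<close>

lemma bounded_clinear_right: "bounded_clinear (t a)"
proof -
  have "unital_star_hom (\<lambda>b. t 1 b)"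
    by (simp add: unital_star_hom_def clinear_def add_right scaleC_right one mult star)
  then have "bounded_clinear (\<lambda>b. t 1 b)" by (rule star_hom_bounded_clinear)
  then show ?thesis
    using bounded_clinear_mult_left[of "\<lambda>b. t 1 b" "t a 1"] by (simp add: mult)
qed

text \<open>First the slices \<open>\<phi> \<otimes> \<iota>\<close> for \<open>\<phi>\<close> in a faithful family \<open>N\<close>, and then \<open>\<iota> \<otimes> \<omega>\<close> by the requirement
  \<open>\<phi>((\<iota> \<otimes> \<omega>) x) = \<omega>((\<phi> \<otimes> \<iota>) x)\<close> for all \<open>\<phi> \<in> N\<close>.\<close>

lemma slice_exists:
  assumes \<omega>: "bounded_clinear \<omega>"
  shows "\<exists>S. bounded_clinear S \<and> (\<forall>a b. S (t a b) = \<omega> b *\<^sub>C a) \<and>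
    (pos_functional \<omega> \<longrightarrow> (\<forall>x. \<exists>s. S (star x * x) = star s * s))"
proof -
  obtain N M where N: "faithful_family N" and M: "faithful_family M"
    and "\<forall>\<phi>\<in>N. \<forall>\<psi>\<in>M. \<exists>\<theta>. pos_functional \<theta> \<and> (\<forall>a b. \<theta> (t a b) = \<phi> a * \<psi> b)"
    using product_functionals by blast
  then obtain \<Theta> where \<Theta>: "\<And>\<phi> \<psi>. \<phi> \<in> N \<Longrightarrow> \<psi> \<in> M \<Longrightarrow> pos_functional (\<Theta> \<phi> \<psi>)"
    and \<Theta>t: "\<And>\<phi> \<psi> a b. \<phi> \<in> N \<Longrightarrow> \<psi> \<in> M \<Longrightarrow> \<Theta> \<phi> \<psi> (t a b) = \<phi> a * \<psi> b"
    by metis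
  note Nlin = pos_functional_clinear[OF faithful_family_pos[OF N]]
  note Mlin = pos_functional_clinear[OF faithful_family_pos[OF M]]
  have N1: "\<phi> 1 \<in> \<real>\<^sub>\<ge>\<^sub>0" if "\<phi> \<in> N" for \<phi>
    by (rule pos_functional_one[OF faithful_family_pos[OF N that]])
  have M1: "\<psi> 1 \<in> \<real>\<^sub>\<ge>\<^sub>0" if "\<psi> \<in> M" for \<psi>
    by (rule pos_functional_one[OF faithful_family_pos[OF M that]])
  have "\<exists>S. bounded_clinear S \<and> (\<forall>a b. S (t a b) = \<phi> a *\<^sub>C b) \<and>
      (\<forall>x. norm (S x) \<le> 4 * Re (\<phi> 1) * norm x) \<and> (\<forall>x. \<exists>s. S (star x * x) = star s * s)"
    if \<phi>: "\<phi> \<in> N" for \<phi>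
  proof (rule dual_extension[OF M dense, of "\<Theta> \<phi>" "2 * Re (\<phi> 1)"])
    show "clinear (\<Theta> \<phi> \<psi>)" if "\<psi> \<in> M" for \<psi> by (rule pos_functional_clinear[OF \<Theta>[OF \<phi> that]])
    show "0 \<le> 2 * Re (\<phi> 1)" using N1[OF \<phi>] by (simp add: complex_nonneg_Reals_iff)
    \<comment> \<open>By \<open>t 1 1 = 1\<close>, the functional
      \<open>\<Theta> \<phi> \<psi>\<close> has the value \<open>\<phi> 1 * \<psi> 1\<close> at
      \<open>1\<close>. The 2 from \<open>pos_functional_bound\<close> and the 2 from
      \<open>dual_extension\<close> make up the 4 in the bound for this slice.\<close>
    show "norm (\<Theta> \<phi> \<psi> x) \<le> 2 * Re (\<phi> 1) * Re (\<psi> 1) * norm x" if "\<psi> \<in> M" for \<psi> x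
      using pos_functional_bound[OF \<Theta>[OF \<phi> that], of x] \<Theta>t[OF \<phi> that, of 1 1] N1[OF \<phi>] M1[OF that]
      by (simp add: one complex_nonneg_Reals_iff mult.assoc)
    show "\<exists>b. \<forall>\<psi>\<in>M. \<psi> b = \<Theta> \<phi> \<psi> x" if x: "x \<in> {t a b | a b. True}" for x
    proof -
      obtain a b where "x = t a b" using x by blast
      then have "\<forall>\<psi>\<in>M. \<psi> (\<phi> a *\<^sub>C b) = \<Theta> \<phi> \<psi> x"
        by (simp add: \<Theta>t[OF \<phi>] clinear_scaleC[OF Mlin] scaleC_complex_def)
      then show ?thesis by blast
    qed
  next
    fix S assume S: "bounded_clinear S" "\<And>\<psi> x. \<psi> \<in> M \<Longrightarrow> \<psi> (S x) = \<Theta> \<phi> \<psi> x"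
      "\<And>x. norm (S x) \<le> 2 * (2 * Re (\<phi> 1)) * norm x"
    have "S (t a b) = \<phi> a *\<^sub>C b" for a b
      by (rule faithful_family_eq[OF M])
        (simp add: S \<Theta>t[OF \<phi>] clinear_scaleC[OF Mlin] scaleC_complex_def)
    moreover have "\<exists>s. S (star x * x) = star s * s" for x
    proof -
      have "\<psi> (S (star x * x)) \<in> \<real>\<^sub>\<ge>\<^sub>0" if "\<psi> \<in> M" for \<psi>
        using pos_functional_nonneg[OF \<Theta>[OF \<phi> that]] S(2)[OF that] by simp
      then show ?thesis using faithful_family_sqrt[OF M, of "S (star x * x)"] by metis
    qed
    ultimately show ?thesis using S by (auto intro!: exI[of _ S])
  qed
  then have "\<forall>\<phi>\<in>N. \<exists>S. bounded_clinear S \<and> (\<forall>a b. S (t a b) = \<phi> a *\<^sub>C b) \<and>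
      (\<forall>x. norm (S x) \<le> 4 * Re (\<phi> 1) * norm x) \<and> (\<forall>x. \<exists>s. S (star x * x) = star s * s)"
    by (rule ballI)
  from bchoice[OF this] obtain L where L_all: "\<forall>\<phi>\<in>N. bounded_clinear (L \<phi>) \<and>
      (\<forall>a b. L \<phi> (t a b) = \<phi> a *\<^sub>C b) \<and> (\<forall>x. norm (L \<phi> x) \<le> 4 * Re (\<phi> 1) * norm x) \<and>
      (\<forall>x. \<exists>s. L \<phi> (star x * x) = star s * s)" ..
  have L: "bounded_clinear (L \<phi>)" and Lt: "L \<phi> (t a b) = \<phi> a *\<^sub>C b"
    and Ln: "norm (L \<phi> x) \<le> 4 * Re (\<phi> 1) * norm x"
    and Lpos: "\<exists>s. L \<phi> (star x * x) = star s * s" if "\<phi> \<in> N" for \<phi> a b x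
  proof -
    note * = bspec[OF L_all that]
    show "bounded_clinear (L \<phi>)" using * by (rule conjunct1)
    show "L \<phi> (t a b) = \<phi> a *\<^sub>C b" by (rule *[THEN conjunct2, THEN conjunct1, rule_format])
    show "norm (L \<phi> x) \<le> 4 * Re (\<phi> 1) * norm x"
      by (rule *[THEN conjunct2, THEN conjunct2, THEN conjunct1, rule_format])
    show "\<exists>s. L \<phi> (star x * x) = star s * s"
      by (rule *[THEN conjunct2, THEN conjunct2, THEN conjunct2, rule_format])
  qed
  obtain C where C: "0 \<le> C" "\<And>y. norm (\<omega> y) \<le> norm y * C"
    using bounded_linear.nonneg_bounded[OF bounded_clinear_bounded_linear[OF \<omega>]] by blast
  note \<omega>lin = bounded_clinear_clinear[OF \<omega>]
  show ?thesis
  proof (rule dual_extension[OF N dense, of "\<lambda>\<phi> x. \<omega> (L \<phi> x)" "4 * C"])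
    show "clinear (\<lambda>x. \<omega> (L \<phi> x))" if "\<phi> \<in> N" for \<phi>
      by (rule clinear_compose[OF \<omega>lin bounded_clinear_clinear[OF L[OF that]]])
    show "0 \<le> 4 * C" using C by simp
    show "norm (\<omega> (L \<phi> x)) \<le> 4 * C * Re (\<phi> 1) * norm x" if "\<phi> \<in> N" for \<phi> x
      using C(2)[of "L \<phi> x"] mult_right_mono[OF Ln[OF that, of x] C(1)] by (simp add: mult_ac)
    show "\<exists>a. \<forall>\<phi>\<in>N. \<phi> a = \<omega> (L \<phi> x)" if x: "x \<in> {t a b | a b. True}" for x
    proof -
      obtain a b where "x = t a b" using x by blast
      then have "\<forall>\<phi>\<in>N. \<phi> (\<omega> b *\<^sub>C a) = \<omega> (L \<phi> x)"
        by (simp add: Lt clinear_scaleC[OF Nlin] clinear_scaleC[OF \<omega>lin] scaleC_complex_def)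
      then show ?thesis by blast
    qed
  next
    fix S assume S: "bounded_clinear S" "\<And>\<phi> x. \<phi> \<in> N \<Longrightarrow> \<phi> (S x) = \<omega> (L \<phi> x)"
    have "S (t a b) = \<omega> b *\<^sub>C a" for a b
      by (rule faithful_family_eq[OF N])
        (simp add: S Lt clinear_scaleC[OF Nlin] clinear_scaleC[OF \<omega>lin] scaleC_complex_def)
    \<comment> \<open>As \<open>L \<phi> (star x * x)\<close> is a square, every positive
      \<open>\<omega>\<close> is nonnegative there; \<open>faithful_family_sqrt\<close> turns this
      back into a square.\<close>
    moreover have "\<exists>s. S (star x * x) = star s * s" if "pos_functional \<omega>" for x
    proof -
      have "\<phi> (S (star x * x)) \<in> \<real>\<^sub>\<ge>\<^sub>0" if "\<phi> \<in> N" for \<phi>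
        using S(2)[OF that] Lpos[OF that, of x] pos_functional_nonneg[OF \<open>pos_functional \<omega>\<close>] by auto
      then show ?thesis using faithful_family_sqrt[OF N, of "S (star x * x)"] by metis
    qed
    ultimately show ?thesis using S by (auto intro!: exI[of _ S])
  qed
qed

lemma slice_right_eqI:
  assumes "bounded_clinear S" "\<And>a b. S (t a b) = \<omega> b *\<^sub>C a"
  shows "slice_right t \<omega> = S"
  unfolding slice_right_def
proof (rule the_equality)
  fix S' assume S': "bounded_clinear S' \<and> (\<forall>a b. S' (t a b) = \<omega> b *\<^sub>C a)"
  show "S' = S"
    by (rule ext, rule tensor_ext[OF conjunct1[OF S'] assms(1)]) (simp add: S' assms(2))
qed (simp add: assms)

lemma
  assumes "bounded_clinear \<omega>"
  shows bounded_clinear_slice: "bounded_clinear (slice_right t \<omega>)"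
    and slice_tensor: "slice_right t \<omega> (t a b) = \<omega> b *\<^sub>C a"
    and slice_positive: "pos_functional \<omega> \<Longrightarrow> \<exists>s. slice_right t \<omega> (star x * x) = star s * s"
proof -
  from slice_exists[OF assms] obtain S where S: "bounded_clinear S" "\<And>a b. S (t a b) = \<omega> b *\<^sub>C a"
    and pos: "pos_functional \<omega> \<Longrightarrow> \<forall>x. \<exists>s. S (star x * x) = star s * s" by blast
  have eq: "slice_right t \<omega> = S" using S by (rule slice_right_eqI)
  show "bounded_clinear (slice_right t \<omega>)" "slice_right t \<omega> (t a b) = \<omega> b *\<^sub>C a"
    unfolding eq by (rule S)+
  show "\<exists>s. slice_right t \<omega> (star x * x) = star s * s" if "pos_functional \<omega>"
    unfolding eq using pos[OF that] by (rule spec)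
qed

lemma slice_one: "bounded_clinear \<omega> \<Longrightarrow> slice_right t \<omega> 1 = \<omega> 1 *\<^sub>C 1"
  using slice_tensor[of \<omega> 1 1] by (simp add: one)

lemma slice_mult_left:
  assumes "bounded_clinear \<omega>"
  shows "slice_right t \<omega> (t c 1 * x) = c * slice_right t \<omega> x"
  by (rule tensor_ext[where x = x,
        OF bounded_clinear_compose[OF bounded_clinear_slice[OF assms] bounded_clinear_mult_left[OF bounded_clinear_ident]]
          bounded_clinear_mult_left[OF bounded_clinear_slice[OF assms]]])
    (simp add: mult slice_tensor[OF assms] mult_scaleC_right)

lemma slice_mult_right:
  assumes "bounded_clinear \<omega>"
  shows "slice_right t \<omega> (x * t c 1) = slice_right t \<omega> x * c"
  by (rule tensor_ext[where x = x,
        OF bounded_clinear_compose[OF bounded_clinear_slice[OF assms] bounded_clinear_mult_right[OF bounded_clinear_ident]]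
          bounded_clinear_mult_right[OF bounded_clinear_slice[OF assms]]])
    (simp add: mult slice_tensor[OF assms] mult_scaleC_left)

lemma slice_star:
  assumes "pos_functional \<omega>"
  shows "slice_right t \<omega> (star x) = star (slice_right t \<omega> x)"
proof -
  note b = pos_functional_bounded_clinear[OF assms]
  have "star (slice_right t \<omega> (star x)) = slice_right t \<omega> x"
    by (rule tensor_ext[where x = x,
          OF bounded_clinear_star_star[OF bounded_clinear_slice[OF b]] bounded_clinear_slice[OF b]])
      (simp add: star slice_tensor[OF b] pos_functional_star[OF assms] star_scaleC star_star)
  then show ?thesis by (metis star_star)
qed

lemma slice_diff:
  assumes "bounded_clinear \<omega>" "bounded_clinear \<rho>"
  shows "slice_right t (\<lambda>b. \<omega> b - \<rho> b) x = slice_right t \<omega> x - slice_right t \<rho> x"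
  by (rule tensor_ext[where x = x,
        OF bounded_clinear_slice[OF bounded_clinear_diff[OF assms]]
          bounded_clinear_diff[OF assms[THEN bounded_clinear_slice]]])
    (simp add: slice_tensor[OF bounded_clinear_diff[OF assms]] assms[THEN slice_tensor]
      complex_vector.scale_left_diff_distrib)

lemma slice_scaleC:
  assumes "bounded_clinear \<omega>"
  shows "slice_right t (\<lambda>b. c * \<omega> b) x = c *\<^sub>C slice_right t \<omega> x"
proof -
  have *: "bounded_clinear (\<lambda>b. c * \<omega> b)"
    using bounded_clinear_scaleC[OF assms, of c] by (simp add: scaleC_complex_def)
  show ?thesis
    by (rule tensor_ext[where x = x,
          OF bounded_clinear_slice[OF *] bounded_clinear_scaleC[OF bounded_clinear_slice[OF assms]]])
      (simp add: slice_tensor[OF *] slice_tensor[OF assms] scaleC_scaleC)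
qed

end

lemma slice_left_eq: "slice_left t \<omega> = slice_right (\<lambda>b a. t a b) \<omega>"
  unfolding slice_left_def slice_right_def
  by (rule arg_cong[where f = The]) (auto simp: fun_eq_iff)

text \<open>Both sides are the bounded functional \<phi> \<otimes> \<omega>. This is the link
  between left and right slices.\<close>

lemma (in cstar_tensor) slice_fubini:
  assumes \<phi>: "bounded_clinear \<phi>" and \<omega>: "bounded_clinear \<omega>"
  shows "\<phi> (slice_right t \<omega> x) = \<omega> (slice_left t \<phi> x)"
proof -
  interpret flip: cstar_tensor "\<lambda>b a. t a b"
    by (rule cstar_tensor_flip) (rule cstar_tensor_axioms)
  show ?thesis
    unfolding slice_left_eq
    by (rule tensor_ext[where x = x,
          OF bounded_clinear_compose[OF \<phi> bounded_clinear_slice[OF \<omega>]]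
            bounded_clinear_compose[OF \<omega> flip.bounded_clinear_slice[OF \<phi>]]])
      (simp add: slice_tensor[OF \<omega>] flip.slice_tensor[OF \<phi>] scaleC_complex_def
        clinear_scaleC[OF bounded_clinear_clinear[OF \<phi>]] clinear_scaleC[OF bounded_clinear_clinear[OF \<omega>]])
qed

section \<open>The state space\<close>

lemma state_pos_functional: "state h \<Longrightarrow> pos_functional h"
  and state_one: "state h \<Longrightarrow> h 1 = 1"
  by (simp_all add: state_iff_pos_functional)

lemma state_bounded_clinear: "state h \<Longrightarrow> bounded_clinear h"
  by (rule pos_functional_bounded_clinear[OF state_pos_functional])

lemma state_bound: "state h \<Longrightarrow> norm (h a) \<le> 2 * norm a"
  using pos_functional_bound[OF state_pos_functional, of h a] by (simp add: state_one)

lemma pos_functional_cmult: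
  assumes "pos_functional f" "0 \<le> r"
  shows "pos_functional (\<lambda>a. complex_of_real r * f a)"
  using assms by (simp add: pos_functional_def clinear_def scaleC_complex_def distrib_left
      complex_nonneg_Reals_iff)

lemma pos_functional_sum:
  assumes "\<And>i. i \<in> I \<Longrightarrow> pos_functional (f i)"
  shows "pos_functional (\<lambda>a. \<Sum>i\<in>I. f i a)"
  using assms
  by (simp add: pos_functional_def clinear_def scaleC_complex_def sum.distrib sum_distrib_left
      complex_nonneg_Reals_iff sum_nonneg)

lemma state_mean:
  assumes "finite I" "I \<noteq> {}" and st: "\<And>i. i \<in> I \<Longrightarrow> state (f i)"
  shows "state (\<lambda>a. complex_of_real (1 / card I) * (\<Sum>i\<in>I. f i a))"
  unfolding state_iff_pos_functional
proof
  show "pos_functional (\<lambda>a. complex_of_real (1 / card I) * (\<Sum>i\<in>I. f i a))"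
    by (rule pos_functional_cmult[OF pos_functional_sum[OF state_pos_functional[OF st]]]) auto
  show "complex_of_real (1 / card I) * (\<Sum>i\<in>I. f i 1) = 1"
    using assms by (simp add: state_one)
qed

lemma pos_functional_normalize:
  assumes f: "pos_functional f" and "f 1 \<noteq> 0"
  obtains \<omega> where "state \<omega>" "\<And>a. f a = f 1 * \<omega> a"
proof
  have r: "complex_of_real (Re (f 1)) = f 1" "0 \<le> Re (f 1)"
    using pos_functional_one[OF f] by (simp_all add: complex_nonneg_Reals_iff complex_eq_iff)
  have i: "complex_of_real (1 / Re (f 1)) = 1 / f 1"
    using r(1) by simp
  show "state (\<lambda>a. complex_of_real (1 / Re (f 1)) * f a)"
    unfolding state_iff_pos_functional
    using pos_functional_cmult[OF f, of "1 / Re (f 1)"] r(2) assms(2) i by simp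
  show "f a = f 1 * (complex_of_real (1 / Re (f 1)) * f a)" for a
    unfolding i using assms(2) by simp
qed

lemma pos_functional_eq_zero:
  assumes "pos_functional f" "f 1 = 0"
  shows "f a = 0"
  using pos_functional_bound[OF assms(1), of a] assms(2) by simp

text \<open>Without states no member of \<open>N\<close> could be normalised, so all would vanish at
  \<open>1\<close>, and \<open>N\<close> would not separate \<open>1\<close> from
  \<open>0\<close>.\<close>

lemma faithful_family_ex_state:
  fixes N :: "('a::unital_cstar_algebra \<Rightarrow> complex) set"
  assumes N: "faithful_family N"
  shows "\<exists>\<omega> :: 'a \<Rightarrow> complex. state \<omega>"
proof (rule ccontr)
  assume no: "\<nexists>\<omega> :: 'a \<Rightarrow> complex. state \<omega>"
  have "(1::'a) = 0"
  proof (rule faithful_family_eq[OF N])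
    fix \<omega> assume "\<omega> \<in> N"
    then have p: "pos_functional \<omega>" by (rule faithful_family_pos[OF N])
    then show "\<omega> 1 = \<omega> 0"
      using pos_functional_normalize[OF p] no clinear_zero[OF pos_functional_clinear[OF p]] by metis
  qed
  then show False by simp
qed

text \<open>Banach-Alaoglu by way of Tychonoff: the function type carries the topology of pointwise
  convergence, in which the states are a closed part of a product of discs.\<close>

lemma compact_states: "compact {h :: 'a::unital_cstar_algebra \<Rightarrow> complex. state h}"
proof -
  have coord: "continuous_on UNIV (\<lambda>h :: 'a \<Rightarrow> complex. h a)" for a by simp
  have "compactin (product_topology (\<lambda>_. euclidean) UNIV) (PiE UNIV (\<lambda>a :: 'a. cball (0::complex) (2 * norm a)))"
    by (simp add: compactin_PiE)
  then have K: "compact (PiE UNIV (\<lambda>a :: 'a. cball (0::complex) (2 * norm a)))"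
    by (simp add: euclidean_product_topology)
  have "closed {h :: 'a \<Rightarrow> complex. ((\<forall>x y. h (x + y) = h x + h y) \<and> (\<forall>c x. h (c *\<^sub>C x) = c * h x)) \<and>
      (\<forall>a. 0 \<le> Re (h (star a * a)) \<and> Im (h (star a * a)) = 0) \<and> h 1 = 1}"
    by (intro closed_Collect_conj closed_Collect_all closed_Collect_eq closed_Collect_le
        continuous_on_add continuous_on_mult continuous_on_const continuous_on_Re continuous_on_Im coord)
  then have "closed {h :: 'a \<Rightarrow> complex. state h}"
    by (simp only: state_def clinear_def scaleC_complex_def complex_nonneg_Reals_iff)
  moreover have "{h :: 'a \<Rightarrow> complex. state h} =
      PiE UNIV (\<lambda>a :: 'a. cball (0::complex) (2 * norm a)) \<inter> {h. state h}"
    by (auto simp: state_bound)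
  ultimately show ?thesis using K by (metis compact_Int_closed)
qed

text \<open>Without separability there need be no convergent subsequence, hence a cluster point of a
  filter. Asymptotic equalities along the sequence hold exactly at such a point, and only this is
  recorded.\<close>

lemma state_cluster:
  fixes m :: "nat \<Rightarrow> 'a::unital_cstar_algebra \<Rightarrow> complex"
  assumes st: "\<And>n. state (m n)"
  shows "\<exists>h. state h \<and> (\<forall>a b. ((\<lambda>n. m n a - m n b) \<longlonglongrightarrow> 0) \<longrightarrow> h a = h b)"
proof -
  define Fm where "Fm = filtermap m sequentially"
  have "Fm \<noteq> bot" by (simp add: Fm_def filtermap_bot_iff)
  moreover have "eventually (\<lambda>h. h \<in> {h. state h}) Fm" by (simp add: Fm_def eventually_filtermap st)
  ultimately obtain h where h: "state h" "inf (nhds h) Fm \<noteq> bot"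
    using compact_states[where 'a = 'a, unfolded compact_filter] by blast
  have nh: "((\<lambda>g. g a) \<longlongrightarrow> h a) (nhds h)" for a :: 'a
  proof (rule topological_tendstoI)
    fix S assume "open S" "h a \<in> S"
    moreover from this have "open ((\<lambda>g :: 'a \<Rightarrow> complex. g a) -` S)" by (intro open_vimage) simp_all
    ultimately show "\<forall>\<^sub>F g in nhds h. g a \<in> S" unfolding eventually_nhds by fastforce
  qed
  have "h a = h b" if ab: "(\<lambda>n. m n a - m n b) \<longlonglongrightarrow> 0" for a b
  proof -
    have "((\<lambda>g. g a - g b) \<longlongrightarrow> 0) Fm" using ab by (simp add: Fm_def filterlim_filtermap)
    then have "((\<lambda>g. g a - g b) \<longlongrightarrow> 0) (inf (nhds h) Fm)" by (rule tendsto_mono[OF inf_le2])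
    moreover have "((\<lambda>g. g a - g b) \<longlongrightarrow> h a - h b) (inf (nhds h) Fm)"
      by (rule tendsto_mono[OF inf_le1 tendsto_diff[OF nh nh]])
    ultimately have "h a - h b = 0" using h(2) tendsto_unique by blast
    then show ?thesis by simp
  qed
  with h(1) show ?thesis by blast
qed

section \<open>Invariant states\<close>

text \<open>Only one of the two density conditions is assumed; the other one is this condition for the
  flipped data.\<close>

locale cancellative_quantum_semigroup =
  fixes t :: "'a::unital_cstar_algebra \<Rightarrow> 'a \<Rightarrow> 't::unital_cstar_algebra"
    and tL :: "'t \<Rightarrow> 'a \<Rightarrow> 'u::unital_cstar_algebra"
    and tR :: "'a \<Rightarrow> 't \<Rightarrow> 'u"
    and \<Phi> :: "'a \<Rightarrow> 't" and F G :: "'t \<Rightarrow> 'u"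
  assumes t: "cstar_tensor t" and tL: "cstar_tensor tL" and tR: "cstar_tensor tR"
    and cube: "tL (t a b) c = tR a (t b c)"
    and hom: "unital_star_hom \<Phi>"
    and F: "bounded_clinear F" and F_tensor: "F (t a b) = tL (\<Phi> a) b"
    and G: "bounded_clinear G" and G_tensor: "G (t a b) = tR a (\<Phi> b)"
    and coassoc: "F (\<Phi> a) = G (\<Phi> a)"
    and cancel: "closure (complex_vector.span {\<Phi> a * t b 1 | a b. True}) = UNIV"
begin

sublocale T: cstar_tensor t by (rule t)
sublocale TL: cstar_tensor tL by (rule tL)
sublocale TR: cstar_tensor tR by (rule tR)

lemmas hom_simps = unital_star_homD[OF hom]

lemma bounded_clinear_hom: "bounded_clinear \<Phi>"
  by (rule star_hom_bounded_clinear[OF hom])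

text \<open>The convolution operator (\<iota> \<otimes> \<omega>)\<Phi>. Composing functionals with
  it yields the product (\<omega> \<otimes> \<rho>)\<Phi> without forming a tensor product of
  functionals.\<close>

definition E :: "('a \<Rightarrow> complex) \<Rightarrow> 'a \<Rightarrow> 'a" where
  "E \<omega> a = slice_right t \<omega> (\<Phi> a)"

definition conv :: "('a \<Rightarrow> complex) \<Rightarrow> ('a \<Rightarrow> complex) \<Rightarrow> 'a \<Rightarrow> complex" where
  "conv \<omega> \<rho> a = \<omega> (E \<rho> a)"

lemma bounded_clinear_E: "bounded_clinear \<omega> \<Longrightarrow> bounded_clinear (E \<omega>)"
  unfolding E_def[abs_def]
  by (rule bounded_clinear_compose[OF T.bounded_clinear_slice bounded_clinear_hom])

lemma bounded_clinear_conv: "bounded_clinear \<omega> \<Longrightarrow> bounded_clinear \<rho> \<Longrightarrow> bounded_clinear (conv \<omega> \<rho>)"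
  unfolding conv_def[abs_def] by (rule bounded_clinear_compose[OF _ bounded_clinear_E])

lemma E_one: "bounded_clinear \<omega> \<Longrightarrow> E \<omega> 1 = \<omega> 1 *\<^sub>C 1"
  by (simp add: E_def hom_simps T.slice_one)

lemma state_conv:
  assumes \<omega>: "state \<omega>" and \<rho>: "state \<rho>"
  shows "state (conv \<omega> \<rho>)"
  unfolding state_def
proof (intro conjI allI)
  show "clinear (conv \<omega> \<rho>)"
    by (intro bounded_clinear_clinear bounded_clinear_conv state_bounded_clinear assms)
  fix a
  obtain s where "E \<rho> (star a * a) = star s * s"
    using T.slice_positive[OF state_bounded_clinear[OF \<rho>] state_pos_functional[OF \<rho>], of "\<Phi> a"]
    by (auto simp: E_def hom_simps)
  then show "conv \<omega> \<rho> (star a * a) \<in> \<real>\<^sub>\<ge>\<^sub>0"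
    using \<omega> by (simp add: conv_def state_def)
next
  show "conv \<omega> \<rho> 1 = 1"
    using state_bounded_clinear[OF \<rho>] state_one[OF \<rho>] state_one[OF \<omega>]
    by (simp add: conv_def E_one scaleC_one)
qed

text \<open>Here \<open>\<rho>\<close> is evaluated at a point depending only on
  \<open>\<omega>\<close> and \<open>a\<close>, so that \<open>conv \<omega> \<rho> = \<rho>\<close>
  is stable under pointwise limits of \<open>\<rho>\<close>.\<close>

lemma conv_eq_slice_left:
  "bounded_clinear \<omega> \<Longrightarrow> bounded_clinear \<rho> \<Longrightarrow> conv \<omega> \<rho> a = \<rho> (slice_left t \<omega> (\<Phi> a))"
  unfolding conv_def E_def by (rule T.slice_fubini)

text \<open>This is \<iota> \<otimes> \<omega> \<otimes> \<rho> applied to the coassociativity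
  equation; \<open>slice_right tL \<rho>\<close> plays the role of \<iota> \<otimes> \<iota>
  \<otimes> \<rho>.\<close>

lemma E_E:
  assumes \<omega>: "bounded_clinear \<omega>" and \<rho>: "bounded_clinear \<rho>"
  shows "E \<omega> (E \<rho> a) = E (conv \<omega> \<rho>) a"
proof -
  have 1: "\<Phi> (slice_right t \<rho> x) = slice_right tL \<rho> (F x)" for x
    by (rule T.tensor_ext[OF bounded_clinear_compose[OF bounded_clinear_hom T.bounded_clinear_slice[OF \<rho>]]
          bounded_clinear_compose[OF TL.bounded_clinear_slice[OF \<rho>] F]])
      (simp add: T.slice_tensor[OF \<rho>] TL.slice_tensor[OF \<rho>] F_tensor clinear_scaleC[OF hom_simps(1)])
  have 2: "slice_right tL \<rho> (tR b x) = t b (slice_right t \<rho> x)" for b x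
    by (rule T.tensor_ext[OF bounded_clinear_compose[OF TL.bounded_clinear_slice[OF \<rho>] TR.bounded_clinear_right]
          bounded_clinear_compose[OF T.bounded_clinear_right T.bounded_clinear_slice[OF \<rho>]]])
      (simp add: T.slice_tensor[OF \<rho>] TL.slice_tensor[OF \<rho>] T.scaleC_right flip: cube)
  have 3: "slice_right t \<omega> (slice_right tL \<rho> (G x)) = slice_right t (conv \<omega> \<rho>) x" for x
    by (rule T.tensor_ext[OF bounded_clinear_compose[OF T.bounded_clinear_slice[OF \<omega>]
            bounded_clinear_compose[OF TL.bounded_clinear_slice[OF \<rho>] G]]
          T.bounded_clinear_slice[OF bounded_clinear_conv[OF \<omega> \<rho>]]])
      (simp add: G_tensor 2 T.slice_tensor[OF \<omega>] T.slice_tensor[OF bounded_clinear_conv[OF \<omega> \<rho>]]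
        conv_def E_def)
  show ?thesis unfolding E_def[of \<omega>] E_def[of \<rho>] 1 coassoc 3 by (simp add: E_def)
qed

text \<open>Convolution with \<open>\<omega>\<close> on either side shifts its powers by one, so one
  cluster point of the means is fixed from both sides.\<close>

lemma conv_fixed_state:
  assumes \<omega>: "state \<omega>"
  obtains h where "state h" "conv \<omega> h = h" "conv h \<omega> = h"
proof -
  \<comment> \<open>\<open>w n\<close> is the convolution power of order
    \<open>n + 1\<close>.\<close>
  define w where "w n a = \<omega> ((E \<omega> ^^ n) a)" for n a
  have w0: "w 0 = \<omega>" by (simp add: w_def fun_eq_iff)
  have wS: "w (Suc n) = conv (w n) \<omega>" for n
    by (simp add: w_def conv_def fun_eq_iff funpow_swap1)
  have wstate: "state (w n)" for n
    by (induction n) (simp_all add: w0 wS \<omega> state_conv)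
  note wb = state_bounded_clinear[OF wstate] and \<omega>b = state_bounded_clinear[OF \<omega>]
  \<comment> \<open>This gives the shift of the powers from the left; the shift from the right is
    the recursion \<open>wS\<close>.\<close>
  have Ew: "E (w n) a = (E \<omega> ^^ Suc n) a" for n a
  proof (induction n arbitrary: a)
    case 0
    then show ?case by (simp add: w0)
  next
    case (Suc n)
    have "E (w (Suc n)) a = E (w n) (E \<omega> a)" unfolding wS by (rule E_E[OF wb \<omega>b, symmetric])
    also have "\<dots> = (E \<omega> ^^ Suc n) (E \<omega> a)" by (rule Suc)
    also have "\<dots> = (E \<omega> ^^ Suc (Suc n)) a" by (simp add: funpow_swap1)
    finally show ?case .
  qed
  have w_right: "w n (E \<omega> a) = w (Suc n) a" for n a
    by (simp add: wS conv_def)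
  have w_left: "w n (slice_left t \<omega> (\<Phi> a)) = w (Suc n) a" for n a
    unfolding conv_eq_slice_left[OF \<omega>b wb, symmetric] by (simp only: conv_def Ew w_def)
  define m where "m n a = complex_of_real (1 / card {..<Suc n}) * (\<Sum>k<Suc n. w k a)" for n a
  have mstate: "state (m n)" for n
    unfolding m_def[abs_def] by (rule state_mean) (use wstate in auto)
  \<comment> \<open>From \<open>a\<close> to \<open>b\<close> the powers are shifted by one, so the
    sums telescope to two end terms, each at most \<open>2 * norm a\<close>.\<close>
  have lim: "(\<lambda>n. m n b - m n a) \<longlonglongrightarrow> 0" if ab: "\<And>k. w k b = w (Suc k) a" for a b
  proof (rule Lim_null_comparison)
    have "m n b - m n a = complex_of_real (1 / Suc n) * (w (Suc n) a - w 0 a)" for n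
    proof -
      have "(\<Sum>k<Suc n. w k b) - (\<Sum>k<Suc n. w k a) = w (Suc n) a - w 0 a"
        unfolding ab sum_subtractf[symmetric] by (rule sum_lessThan_telescope)
      then show ?thesis by (simp only: m_def card_lessThan flip: right_diff_distrib)
    qed
    moreover have "norm (w (Suc n) a - w 0 a) \<le> 4 * norm a" for n
      using norm_triangle_ineq4[of "w (Suc n) a" "w 0 a"] state_bound[OF wstate, of "Suc n" a]
        state_bound[OF wstate, of 0 a] by linarith
    ultimately show "\<forall>\<^sub>F n in sequentially. norm (m n b - m n a) \<le> (1 / Suc n) * (4 * norm a)"
      by (simp only: norm_mult norm_of_real) (auto intro!: always_eventually divide_right_mono)
    show "(\<lambda>n. (1 / Suc n) * (4 * norm a)) \<longlonglongrightarrow> 0"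
      using tendsto_mult_left_zero[OF LIMSEQ_inverse_real_of_nat, of "4 * norm a"]
      by (simp add: inverse_eq_divide)
  qed
  obtain h where h: "state h" "\<And>a b. (\<lambda>n. m n a - m n b) \<longlonglongrightarrow> 0 \<Longrightarrow> h a = h b"
    using state_cluster[of m, OF mstate] by blast
  show thesis
  proof (rule that[OF h(1)])
    show "conv \<omega> h = h"
      by (simp add: fun_eq_iff conv_eq_slice_left[OF \<omega>b state_bounded_clinear[OF h(1)]]
          h(2)[OF lim[OF w_left]])
    show "conv h \<omega> = h"
      by (simp add: fun_eq_iff conv_def h(2)[OF lim[OF w_right]])
  qed
qed

text \<open>The functional is h \<otimes> \<rho>; the slice of \<open>star x * x\<close> under a
  positive \<open>\<rho>\<close> is again of this form.\<close>

lemma pos_functional_slice: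
  assumes h: "pos_functional h" and \<rho>: "pos_functional \<rho>"
  shows "pos_functional (\<lambda>x. h (slice_right t \<rho> x))"
  unfolding pos_functional_def
proof (intro conjI allI)
  note \<rho>b = pos_functional_bounded_clinear[OF \<rho>]
  show "clinear (\<lambda>x. h (slice_right t \<rho> x))"
    by (rule clinear_compose[OF pos_functional_clinear[OF h]
          bounded_clinear_clinear[OF T.bounded_clinear_slice[OF \<rho>b]]])
  show "h (slice_right t \<rho> (star x * x)) \<in> \<real>\<^sub>\<ge>\<^sub>0" for x
    using T.slice_positive[OF \<rho>b \<rho>, of x] pos_functional_nonneg[OF h] by auto
qed

text \<open>For \<open>b = (\<iota> \<otimes> h)\<Phi>(a)\<close> the functional \<open>h \<otimes> \<omega>\<close> vanishes at \<open>X\<^sup>* X\<close>, where \<open>X = \<Phi>(b) - b \<otimes> 1\<close>.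
  Hence so does \<open>h \<otimes> \<rho>\<close>, and by Cauchy-Schwarz \<open>h \<otimes> \<rho>\<close> vanishes at \<open>(c \<otimes> 1) X\<close>.\<close>

lemma conv_dominated:
  assumes \<omega>: "state \<omega>" and h: "state h" and \<omega>h: "conv \<omega> h = h" and h\<omega>: "conv h \<omega> = h"
    and \<rho>: "pos_functional \<rho>" and le: "pos_functional (\<lambda>x. \<omega> x - \<rho> x)"
  shows "conv \<rho> h a = \<rho> 1 * h a"
proof -
  note \<omega>b = state_bounded_clinear[OF \<omega>] and hb = state_bounded_clinear[OF h]
    and \<rho>b = pos_functional_bounded_clinear[OF \<rho>]
  note hpos = state_pos_functional[OF h] and hlin = clinear_simps[OF bounded_clinear_clinear[OF hb]]
  note slin = clinear_simps[OF bounded_clinear_clinear[OF T.bounded_clinear_slice[OF \<omega>b]]]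
    and rlin = clinear_simps[OF bounded_clinear_clinear[OF T.bounded_clinear_slice[OF \<rho>b]]]
  have key: "h (c * E \<rho> (E h a)) = \<rho> 1 * h (c * E h a)" for c a
  proof -
    define b where "b = E h a"
    have Eb: "E \<omega> b = b" by (simp add: b_def E_E[OF \<omega>b hb] \<omega>h)
    define X where "X = \<Phi> b - t b 1"
    have "star X * X = \<Phi> (star b * b) - star (\<Phi> b) * t b 1 - t (star b) 1 * \<Phi> b + t (star b) 1 * t b 1"
      by (simp add: X_def star_diff T.star hom_simps algebra_simps)
    \<comment> \<open>Since \<open>E \<omega> b = b\<close>, each mixed term contributes
      \<open>- (star b * b)\<close>, and one of them cancels against the last term.\<close>
    then have "slice_right t \<omega> (star X * X) = E \<omega> (star b * b) - star b * b"
      by (simp add: slin T.slice_mult_left[OF \<omega>b] T.slice_mult_right[OF \<omega>b]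
          T.slice_star[OF state_pos_functional[OF \<omega>]] T.slice_tensor[OF \<omega>b] state_one[OF \<omega>]
          scaleC_one Eb flip: E_def)
    then have zero: "h (slice_right t \<omega> (star X * X)) = 0"
      using fun_cong[OF h\<omega>, of "star b * b"] by (simp add: hlin conv_def)
    have "h (slice_right t \<rho> (star X * X)) \<in> \<real>\<^sub>\<ge>\<^sub>0"
      by (rule pos_functional_nonneg[OF pos_functional_slice[OF hpos \<rho>]])
    moreover have "h (slice_right t (\<lambda>x. \<omega> x - \<rho> x) (star X * X)) \<in> \<real>\<^sub>\<ge>\<^sub>0"
      by (rule pos_functional_nonneg[OF pos_functional_slice[OF hpos le]])
    ultimately have "h (slice_right t \<rho> (star X * X)) = 0"
      using zero by (auto simp: T.slice_diff[OF \<omega>b \<rho>b] hlin complex_nonneg_Reals_iff complex_eq_iff)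
    then have "h (slice_right t \<rho> (t c 1 * X)) = 0"
      by (rule pos_functional_null[OF pos_functional_slice[OF hpos \<rho>]])
    then have "h (c * E \<rho> b) - \<rho> 1 * h (c * b) = 0"
      by (simp add: T.slice_mult_left[OF \<rho>b] X_def rlin T.slice_tensor[OF \<rho>b] hlin right_diff_distrib
          mult_scaleC_right scaleC_complex_def flip: E_def)
    then show ?thesis by (simp add: b_def)
  qed
  \<comment> \<open>By \<open>key\<close>, the functional h \<otimes> \<theta> vanishes on all
    products (c \<otimes> 1)\<Phi>(a). Density will force it to vanish at 1 \<otimes> a, where its
    value is \<open>\<theta> a\<close>.\<close>
  define \<theta> where "\<theta> a = conv \<rho> h a - \<rho> 1 * h a" for a
  have \<rho>hb: "bounded_clinear (conv \<rho> h)" by (rule bounded_clinear_conv[OF \<rho>b hb])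
  have shb: "bounded_clinear (\<lambda>a. \<rho> 1 * h a)" by (rule bounded_clinear_mult_left[OF hb])
  have \<theta>b: "bounded_clinear \<theta>"
    unfolding \<theta>_def[abs_def] by (rule bounded_clinear_diff[OF \<rho>hb shb])
  have E\<theta>: "E \<theta> a = E \<rho> (E h a) - \<rho> 1 *\<^sub>C E h a" for a
    unfolding E_E[OF \<rho>b hb] unfolding E_def \<theta>_def[abs_def]
    by (simp add: T.slice_diff[OF \<rho>hb shb] T.slice_scaleC[OF hb])
  define f where "f x = h (slice_right t \<theta> x)" for x
  have fb: "bounded_clinear f"
    unfolding f_def[abs_def] by (rule bounded_clinear_compose[OF hb T.bounded_clinear_slice[OF \<theta>b]])
  have f0: "f (t c 1 * \<Phi> a) = 0" for c a
    using key[of c a]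
    by (simp add: f_def T.slice_mult_left[OF \<theta>b] E\<theta> right_diff_distrib mult_scaleC_right hlin
        scaleC_complex_def flip: E_def)
  \<comment> \<open>Adjoints turn the products (c \<otimes> 1)\<Phi>(a) into those of the density
    hypothesis.\<close>
  have "star (f (star x)) = 0" for x
  proof (rule bounded_clinear_eq_on_dense[OF cancel bounded_clinear_star_star[OF fb], of "\<lambda>_. 0"])
    show "bounded_clinear (\<lambda>_. 0 :: complex)" by (simp add: bounded_clinear_def clinear_def)
    fix x assume "x \<in> {\<Phi> a * t b 1 | a b. True}"
    then obtain a b where "x = \<Phi> a * t b 1" by blast
    then have "star x = t (star b) 1 * \<Phi> (star a)" by (simp add: star_mult T.star hom_simps)
    then show "star (f (star x)) = 0" by (simp add: f0)
  qed
  from this[of "star (t 1 a)"] have "f (t 1 a) = 0"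
    by (metis star_star star_zero)
  then show ?thesis
    by (simp add: f_def T.slice_tensor[OF \<theta>b] hlin state_one[OF h] scaleC_complex_def \<theta>_def)
qed

lemma conv_invariant_state:
  shows "\<exists>h. state h \<and> (\<forall>\<omega>. state \<omega> \<longrightarrow> conv \<omega> h = h)"
proof -
  \<comment> \<open>Written with evaluations of \<open>g\<close> only, the condition is closed for
    pointwise convergence; on states it means \<open>conv \<omega> g = g\<close>.\<close>
  define K where "K \<omega> = {g :: 'a \<Rightarrow> complex. \<forall>a. g (slice_left t \<omega> (\<Phi> a)) = g a}" for \<omega>
  have K: "h \<in> K \<omega> \<longleftrightarrow> conv \<omega> h = h" if "state h" "state \<omega>" for h \<omega>
    using conv_eq_slice_left[OF that(2,1)[THEN state_bounded_clinear]] by (simp add: K_def fun_eq_iff)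
  obtain \<omega>0 :: "'a \<Rightarrow> complex" where \<omega>0: "state \<omega>0"
    using T.product_functionals faithful_family_ex_state by blast
  have "{h. state h} \<inter> \<Inter> (K ` {\<omega>. state \<omega>}) \<noteq> {}"
  proof (rule compact_imp_fip[OF compact_states])
    have "closed (K \<omega>)" for \<omega>
      unfolding K_def by (intro closed_Collect_all closed_Collect_eq) simp_all
    then show "closed S" if "S \<in> K ` {\<omega>. state \<omega>}" for S
      using that by blast
  next
    fix F' assume "finite F'" "F' \<subseteq> K ` {\<omega>. state \<omega>}"
    then obtain I0 where I0: "I0 \<subseteq> {\<omega>. state \<omega>}" "finite I0" "F' = K ` I0"
      by (meson finite_subset_image)
    \<comment> \<open>\<open>\<omega>0\<close> keeps the index set nonempty when \<open>F'\<close>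
      is empty.\<close>
    define I where "I = insert \<omega>0 I0"
    have I: "finite I" "I \<noteq> {}" "\<And>\<omega>. \<omega> \<in> I \<Longrightarrow> state \<omega>" using I0 \<omega>0 by (auto simp: I_def)
    define r where "r = 1 / real (card I)"
    have r: "r > 0" using I by (simp add: r_def card_gt_0_iff)
    define \<mu> where "\<mu> a = complex_of_real r * (\<Sum>\<omega>\<in>I. \<omega> a)" for a
    have \<mu>: "state \<mu>" unfolding \<mu>_def[abs_def] r_def by (rule state_mean[OF I])
    obtain h where h: "state h" "conv \<mu> h = h" "conv h \<mu> = h" using conv_fixed_state[OF \<mu>] .
    have "h \<in> K \<omega>" if \<omega>: "\<omega> \<in> I" for \<omega>
    proof -
      have "pos_functional (\<lambda>a. complex_of_real r * \<omega> a)"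
        using pos_functional_cmult[OF state_pos_functional[OF I(3)[OF \<omega>]]] r by simp
      \<comment> \<open>The mean without one summand stays positive, so
        \<open>conv_dominated\<close> applies to \<open>r\<close> times each member.\<close>
      moreover have "\<mu> a - complex_of_real r * \<omega> a = complex_of_real r * (\<Sum>\<omega>\<in>I - {\<omega>}. \<omega> a)" for a
        unfolding \<mu>_def sum.remove[OF I(1) \<omega>] by (simp add: distrib_left)
      then have "pos_functional (\<lambda>a. \<mu> a - complex_of_real r * \<omega> a)"
        using pos_functional_cmult[OF pos_functional_sum[OF state_pos_functional[OF I(3)]], of "I - {\<omega>}" "\<lambda>x. x" r] r
        by simp
      ultimately have "complex_of_real r * \<omega> (E h a) = (complex_of_real r * \<omega> 1) * h a" for a
        using conv_dominated[OF \<mu> h, of "\<lambda>a. complex_of_real r * \<omega> a" a] by (simp add: conv_def)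
      then have "conv \<omega> h = h"
        using r state_one[OF I(3)[OF \<omega>]] by (simp add: conv_def fun_eq_iff)
      then show ?thesis using K[OF h(1) I(3)[OF \<omega>]] by simp
    qed
    then have "h \<in> {h. state h} \<inter> \<Inter> F'" using h(1) by (simp add: I0(3) I_def)
    then show "{h. state h} \<inter> \<Inter> F' \<noteq> {}" by blast
  qed
  then show ?thesis using K by blast
qed

text \<open>A state fixed by all states satisfies \<phi>(E h a) = \<phi>(1)h(a) for every positive
  \<phi>: normalise if \<phi>(1) is nonzero, otherwise \<phi> = 0. A faithful family then identifies
  \<open>E h a\<close>.\<close>

lemma invariant_state:
  obtains h where "state h" "\<And>a. slice_right t h (\<Phi> a) = h a *\<^sub>C 1"
proof -
  obtain h where h: "state h" and inv: "\<And>\<omega>. state \<omega> \<Longrightarrow> conv \<omega> h = h"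
    using conv_invariant_state by blast
  obtain N :: "('a \<Rightarrow> complex) set" where N: "faithful_family N"
    using T.product_functionals by blast
  have "E h a = h a *\<^sub>C 1" for a
  proof (rule faithful_family_eq[OF N])
    fix \<phi> assume "\<phi> \<in> N"
    then have p: "pos_functional \<phi>" by (rule faithful_family_pos[OF N])
    note lin = clinear_scaleC[OF pos_functional_clinear[OF p]]
    show "\<phi> (E h a) = \<phi> (h a *\<^sub>C 1)"
    proof (cases "\<phi> 1 = 0")
      case True
      then show ?thesis by (simp add: pos_functional_eq_zero[OF p])
    next
      case False
      obtain \<omega> where \<omega>: "state \<omega>" "\<And>a. \<phi> a = \<phi> 1 * \<omega> a"
        using pos_functional_normalize[OF p False] by metis
      have "\<phi> (E h a) = \<phi> 1 * h a"
        using \<omega>(2)[of "E h a"] fun_cong[OF inv[OF \<omega>(1)], of a] by (simp add: conv_def)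
      then show ?thesis by (simp add: lin scaleC_complex_def)
    qed
  qed
  then show thesis using that h by (simp add: E_def)
qed

end

text \<open>Reversing the order of the three tensor factors exchanges \<open>tL\<close> with
  \<open>tR\<close> and \<open>F\<close> with \<open>G\<close>, and reads coassociativity
  backwards.\<close>

lemma cancellative_quantum_semigroup_flip:
  assumes "cancellative_quantum_semigroup t tL tR \<Phi> F G"
    and "closure (complex_vector.span {\<Phi> a * t 1 b | a b. True}) = UNIV"
  shows "cancellative_quantum_semigroup (\<lambda>a b. t b a) (\<lambda>x a. tR a x) (\<lambda>a x. tL x a) \<Phi> G F"
proof -
  interpret cancellative_quantum_semigroup t tL tR \<Phi> F G by (rule assms)
  show ?thesis
    by (intro cancellative_quantum_semigroup.intro cstar_tensor_flip[OF t] cstar_tensor_flip[OF tL]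
        cstar_tensor_flip[OF tR] cube[symmetric] hom F G F_tensor G_tensor coassoc[symmetric] assms(2))
qed

theorem theorem4p4:
  fixes t :: "'a::unital_cstar_algebra \<Rightarrow> 'a \<Rightarrow> 't::unital_cstar_algebra"
    and tL :: "'t \<Rightarrow> 'a \<Rightarrow> 'u::unital_cstar_algebra"
    and tR :: "'a \<Rightarrow> 't \<Rightarrow> 'u"
    and \<Phi> :: "'a \<Rightarrow> 't"
  assumes "compact_quantum_group t tL tR \<Phi>"
  shows "(\<exists>!h. state h \<and> left_invariant t \<Phi> h) \<and>
    (\<forall>h. state h \<and> left_invariant t \<Phi> h \<longrightarrow> right_invariant t \<Phi> h)"
proof -
  from assms have cube: "min_tensor_cube t tL tR" and com: "comultiplication t tL tR \<Phi>"
    and d1: "closure (complex_vector.span {\<Phi> a * t 1 b | a b. True}) = UNIV"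
    and d2: "closure (complex_vector.span {\<Phi> a * t b 1 | a b. True}) = UNIV"
    unfolding compact_quantum_group_def by blast+
  from cube have t: "min_tensor t" and tL: "min_tensor tL" and tR: "min_tensor tR"
    and tt: "\<forall>a b c. tL (t a b) c = tR a (t b c)"
    unfolding min_tensor_cube_def by blast+
  from com obtain F G where hom: "unital_star_hom \<Phi>" and F: "bounded_clinear F" "\<forall>a b. F (t a b) = tL (\<Phi> a) b"
    and G: "bounded_clinear G" "\<forall>a b. G (t a b) = tR a (\<Phi> b)" and FG: "\<forall>a. F (\<Phi> a) = G (\<Phi> a)"
    unfolding comultiplication_def by blast
  have half: "cancellative_quantum_semigroup t tL tR \<Phi> F G"
    by (intro cancellative_quantum_semigroup.intro cstar_tensor_min_tensor t tL tR hom F(1) G(1) d2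
        tt[rule_format] F(2)[rule_format] G(2)[rule_format] FG[rule_format])
  interpret cancellative_quantum_semigroup t tL tR \<Phi> F G by (rule half)
  interpret flip: cancellative_quantum_semigroup "\<lambda>a b. t b a" "\<lambda>x a. tR a x" "\<lambda>a x. tL x a" \<Phi> G F
    by (rule cancellative_quantum_semigroup_flip[OF half d1])
  obtain h where h: "state h" "left_invariant t \<Phi> h"
    using invariant_state unfolding left_invariant_def by metis
  obtain k where k: "state k" "right_invariant t \<Phi> k"
    using flip.invariant_state unfolding right_invariant_def slice_left_eq by metis
  \<comment> \<open>Every left invariant state equals the one right invariant state
    \<open>k\<close>, which settles uniqueness and right invariance together.\<close>
  have eq: "g = k" if g: "state g" "left_invariant t \<Phi> g" for g
  proof
    fix a
    note gb = state_bounded_clinear[OF g(1)] and kb = state_bounded_clinear[OF k(1)]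
    have "g a = k (slice_right t g (\<Phi> a))"
      using g(2) state_one[OF k(1)] clinear_scaleC[OF bounded_clinear_clinear[OF kb]]
      by (simp add: left_invariant_def scaleC_complex_def)
    also have "\<dots> = g (slice_left t k (\<Phi> a))" by (rule T.slice_fubini[OF kb gb])
    also have "\<dots> = k a"
      using k(2) state_one[OF g(1)] clinear_scaleC[OF bounded_clinear_clinear[OF gb]]
      by (simp add: right_invariant_def scaleC_complex_def)
    finally show "g a = k a" .
  qed
  show ?thesis
  proof (intro conjI allI impI)
    show "\<exists>!h. state h \<and> left_invariant t \<Phi> h"
      using h eq by (intro ex1I[of _ h]) auto
    show "right_invariant t \<Phi> g" if "state g \<and> left_invariant t \<Phi> g" for g
      using eq[of g] that k(2) by simp
  qed
qed

end
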